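(* Let $\mathfrak g=\mathfrak h\oplus\mathfrak m$ be a reductive decomposition of a simple Lie algebra $\mathfrak g$ over $k$, with $\mathfrak m\neq 0$. Endow $\mathfrak m$ with the Lie-Yamaguti algebra structure given by $$x\cdot y=\pi_{\mathfrak m}([x,y]),\qquad [x,y,z]=[\pi_{\mathfrak h}([x,y]),z]\qquad (x,y,z\in\mathfrak m),$$ where $\pi_{\mathfrak h},\pi_{\mathfrak m}$ are the projections of $\mathfrak g$ onto $\mathfrak h$ and $\mathfrak m$ relative to the decomposition $\mathfrak g=\mathfrak h\oplus\mathfrak m$. Then $\mathfrak g$ and $\mathfrak h$ are isomorphic, respectively, to the standard enveloping Lie algebra $\mathfrak g(\mathfrak m)$ and the inner derivation algebra $D(\mathfrak m,\mathfrak m)$ of the Lie-Yamaguti algebra $(\mathfrak m,x\cdot y,[x,y,z])$. Moreover, in case $\mathfrak h$ is semisimple and $\mathfrak m$ is irreducible as a module for $\mathfrak h$, either $\mathfrak h$ and $\mathfrak m$ are isomorphic as $\operatorname{ad}\mathfrak h$-modules, or $\mathfrak m=\mathfrak h^{\perp}$, the orthogonal complement of $\mathfrak h$ relative to the Killing form of $\mathfrak g$.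
   Context: Throughout, $k$ is an algebraically closed field of characteristic $0$ and all algebraic systems are finite dimensional over $k$. A reductive decomposition of a Lie algebra $\mathfrak g$ is a vector space decomposition $\mathfrak g=\mathfrak h\oplus\mathfrak m$ with $\mathfrak h$ a subalgebra and $[\mathfrak h,\mathfrak m]\subseteq\mathfrak m$. A Lie-Yamaguti algebra (LY-algebra) $(\mathfrak m,x\cdot y,[x,y,z])$ is a vector space $\mathfrak m$ with a bilinear operation $\cdot$ and a trilinear operation $[\,,\,,\,]$ such that for all $x,y,z,t,u,v,w\in\mathfrak m$: (LY1) $x\cdot x=0$; (LY2) $[x,x,y]=0$; (LY3) $\sum_{(x,y,z)}([x,y,z]+(x\cdot y)\cdot z)=0$; (LY4) $\sum_{(x,y,z)}[x\cdot y,z,t]=0$; (LY5) $[x,y,u\cdot v]=[x,y,u]\cdot v+u\cdot[x,y,v]$; (LY6) $[x,y,[u,v,w]]=[[x,y,u],v,w]+[u,[x,y,v],w]+[u,v,[x,y,w]]$, where $\sum_{(x,y,z)}$ is the cyclic sum on $x,y,z$. For $x,y\in\mathfrak m$, $D(x,y):\mathfrak m\to\mathfrak m$ is the inner derivation $z\mapsto[x,y,z]$, and $D(\mathfrak m,\mathfrak m)$ is the linear span of all $D(x,y)$, a Lie algebra under the commutator (the inner derivation algebra). The standard enveloping Lie algebra of $\mathfrak m$ is $\mathfrak g(\mathfrak m)=D(\mathfrak m,\mathfrak m)\oplus\mathfrak m$ with anticommutative bracket extending that of $D(\mathfrak m,\mathfrak m)$ and with $[D(x,y),z]=[x,y,z]$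 and $[z,t]=D(z,t)+z\cdot t$ for $x,y,z,t\in\mathfrak m$. *)

theory Defs
  imports
    "HOL-Computational_Algebra.Polynomial"
    "HOL-Library.Function_Algebras"
    "HOL-Library.Product_Plus"
begin

text \<open>
  Algebraic systems live on a carrier that is a subspace of an ambient additive group with a
  scalar multiplication \<open>s\<close> in the sense of the locale \<^locale>\<open>vector_space\<close>. The operations are
  total functions; only their values on the carrier matter.
\<close>

section \<open>Multilinear maps between subspaces\<close>

definition linear_on ::
    "('k \<Rightarrow> 'a::plus \<Rightarrow> 'a) \<Rightarrow> 'a set \<Rightarrow> ('k \<Rightarrow> 'b::plus \<Rightarrow> 'b) \<Rightarrow> 'b set \<Rightarrow> ('a \<Rightarrow> 'b) \<Rightarrow> bool" where
  "linear_on s V t W f \<longleftrightarrow>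
     (\<forall>x\<in>V. f x \<in> W) \<and>
     (\<forall>x\<in>V. \<forall>y\<in>V. f (x + y) = f x + f y) \<and>
     (\<forall>c. \<forall>x\<in>V. f (s c x) = t c (f x))"

definition bilinear_on ::
    "('k \<Rightarrow> 'a::plus \<Rightarrow> 'a) \<Rightarrow> 'a set \<Rightarrow> ('k \<Rightarrow> 'b::plus \<Rightarrow> 'b) \<Rightarrow> 'b set \<Rightarrow> ('a \<Rightarrow> 'b \<Rightarrow> 'b) \<Rightarrow> bool" where
  "bilinear_on s V t W b \<longleftrightarrow>
     (\<forall>x\<in>V. linear_on t W t W (\<lambda>y. b x y)) \<and>
     (\<forall>y\<in>W. linear_on s V t W (\<lambda>x. b x y))"

definition trilinear_on ::
    "('k \<Rightarrow> 'a::plus \<Rightarrow> 'a) \<Rightarrow> 'a set \<Rightarrow> ('a \<Rightarrow> 'a \<Rightarrow> 'a \<Rightarrow> 'a) \<Rightarrow> bool" where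
  "trilinear_on s V T \<longleftrightarrow>
     (\<forall>x\<in>V. \<forall>y\<in>V. linear_on s V s V (\<lambda>z. T x y z)) \<and>
     (\<forall>x\<in>V. \<forall>z\<in>V. linear_on s V s V (\<lambda>y. T x y z)) \<and>
     (\<forall>y\<in>V. \<forall>z\<in>V. linear_on s V s V (\<lambda>x. T x y z))"


section \<open>Lie algebras\<close>

locale lie_algebra = vector_space s
  for s :: "'k::field \<Rightarrow> 'a::ab_group_add \<Rightarrow> 'a" +
  fixes L :: "'a set" and br :: "'a \<Rightarrow> 'a \<Rightarrow> 'a"
  assumes subspace_carrier: "subspace L"
    and bilinear: "bilinear_on s L s L br"
    and alternating: "x \<in> L \<Longrightarrow> br x x = 0"
    and jacobi: "\<lbrakk>x \<in> L; y \<in> L; z \<in> L\<rbrakk> \<Longrightarrow>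
      br (br x y) z + br (br y z) x + br (br z x) y = 0"

definition lie_subalgebra ::
    "('k::field \<Rightarrow> 'a::ab_group_add \<Rightarrow> 'a) \<Rightarrow> 'a set \<Rightarrow> ('a \<Rightarrow> 'a \<Rightarrow> 'a) \<Rightarrow> 'a set \<Rightarrow> bool" where
  "lie_subalgebra s L br H \<longleftrightarrow>
     H \<subseteq> L \<and> module.subspace s H \<and> (\<forall>x\<in>H. \<forall>y\<in>H. br x y \<in> H)"

definition lie_ideal ::
    "('k::field \<Rightarrow> 'a::ab_group_add \<Rightarrow> 'a) \<Rightarrow> 'a set \<Rightarrow> ('a \<Rightarrow> 'a \<Rightarrow> 'a) \<Rightarrow> 'a set \<Rightarrow> bool" where
  "lie_ideal s L br I \<longleftrightarrow>
     I \<subseteq> L \<and> module.subspace s I \<and> (\<forall>x\<in>L. \<forall>y\<in>I. br x y \<in> I)"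

definition simple_lie_algebra ::
    "('k::field \<Rightarrow> 'a::ab_group_add \<Rightarrow> 'a) \<Rightarrow> 'a set \<Rightarrow> ('a \<Rightarrow> 'a \<Rightarrow> 'a) \<Rightarrow> bool" where
  "simple_lie_algebra s L br \<longleftrightarrow>
     lie_algebra s L br \<and> (\<exists>x\<in>L. \<exists>y\<in>L. br x y \<noteq> 0) \<and>
     (\<forall>I. lie_ideal s L br I \<longrightarrow> I = {0} \<or> I = L)"

primrec derived_series ::
    "('k::field \<Rightarrow> 'a::ab_group_add \<Rightarrow> 'a) \<Rightarrow> 'a set \<Rightarrow> ('a \<Rightarrow> 'a \<Rightarrow> 'a) \<Rightarrow> nat \<Rightarrow> 'a set" where
  "derived_series s L br 0 = L"
| "derived_series s L br (Suc n) =
     module.span s {br x y | x y. x \<in> derived_series s L br n \<and> y \<in> derived_series s L br n}"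

definition solvable_lie_algebra ::
    "('k::field \<Rightarrow> 'a::ab_group_add \<Rightarrow> 'a) \<Rightarrow> 'a set \<Rightarrow> ('a \<Rightarrow> 'a \<Rightarrow> 'a) \<Rightarrow> bool" where
  "solvable_lie_algebra s L br \<longleftrightarrow> lie_algebra s L br \<and> (\<exists>n. derived_series s L br n = {0})"

definition semisimple_lie_algebra ::
    "('k::field \<Rightarrow> 'a::ab_group_add \<Rightarrow> 'a) \<Rightarrow> 'a set \<Rightarrow> ('a \<Rightarrow> 'a \<Rightarrow> 'a) \<Rightarrow> bool" where
  "semisimple_lie_algebra s L br \<longleftrightarrow>
     lie_algebra s L br \<and>
     (\<forall>I. lie_ideal s L br I \<and> solvable_lie_algebra s I br \<longrightarrow> I = {0})"

definition lie_isomorphic ::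
    "('k::field \<Rightarrow> 'a::ab_group_add \<Rightarrow> 'a) \<Rightarrow> 'a set \<Rightarrow> ('a \<Rightarrow> 'a \<Rightarrow> 'a) \<Rightarrow>
     ('k \<Rightarrow> 'b::ab_group_add \<Rightarrow> 'b) \<Rightarrow> 'b set \<Rightarrow> ('b \<Rightarrow> 'b \<Rightarrow> 'b) \<Rightarrow> bool" where
  "lie_isomorphic s L br s' L' br' \<longleftrightarrow>
     lie_algebra s L br \<and> lie_algebra s' L' br' \<and>
     (\<exists>f. linear_on s L s' L' f \<and> bij_betw f L L' \<and>
          (\<forall>x\<in>L. \<forall>y\<in>L. f (br x y) = br' (f x) (f y)))"


section \<open>Modules for a Lie algebra\<close>

definition lie_module ::
    "('k::field \<Rightarrow> 'a::ab_group_add \<Rightarrow> 'a) \<Rightarrow> 'a set \<Rightarrow> ('a \<Rightarrow> 'a \<Rightarrow> 'a) \<Rightarrow>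
     ('k \<Rightarrow> 'v::ab_group_add \<Rightarrow> 'v) \<Rightarrow> 'v set \<Rightarrow> ('a \<Rightarrow> 'v \<Rightarrow> 'v) \<Rightarrow> bool" where
  "lie_module s L br t V act \<longleftrightarrow>
     lie_algebra s L br \<and> vector_space t \<and> module.subspace t V \<and> bilinear_on s L t V act \<and>
     (\<forall>x\<in>L. \<forall>y\<in>L. \<forall>v\<in>V. act (br x y) v = act x (act y v) - act y (act x v))"

definition irreducible_lie_module ::
    "('k::field \<Rightarrow> 'a::ab_group_add \<Rightarrow> 'a) \<Rightarrow> 'a set \<Rightarrow> ('a \<Rightarrow> 'a \<Rightarrow> 'a) \<Rightarrow>
     ('k \<Rightarrow> 'v::ab_group_add \<Rightarrow> 'v) \<Rightarrow> 'v set \<Rightarrow> ('a \<Rightarrow> 'v \<Rightarrow> 'v) \<Rightarrow> bool" where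
  "irreducible_lie_module s L br t V act \<longleftrightarrow>
     lie_module s L br t V act \<and> V \<noteq> {0} \<and>
     (\<forall>W. W \<subseteq> V \<and> module.subspace t W \<and> (\<forall>x\<in>L. \<forall>w\<in>W. act x w \<in> W) \<longrightarrow> W = {0} \<or> W = V)"

definition isomorphic_lie_modules ::
    "('k::field \<Rightarrow> 'a::ab_group_add \<Rightarrow> 'a) \<Rightarrow> 'a set \<Rightarrow> ('a \<Rightarrow> 'a \<Rightarrow> 'a) \<Rightarrow>
     ('k \<Rightarrow> 'v::ab_group_add \<Rightarrow> 'v) \<Rightarrow> 'v set \<Rightarrow> ('a \<Rightarrow> 'v \<Rightarrow> 'v) \<Rightarrow>
     ('k \<Rightarrow> 'w::ab_group_add \<Rightarrow> 'w) \<Rightarrow> 'w set \<Rightarrow> ('a \<Rightarrow> 'w \<Rightarrow> 'w) \<Rightarrow> bool" where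
  "isomorphic_lie_modules s L br t V act t' V' act' \<longleftrightarrow>
     lie_module s L br t V act \<and> lie_module s L br t' V' act' \<and>
     (\<exists>f. linear_on t V t' V' f \<and> bij_betw f V V' \<and>
          (\<forall>x\<in>L. \<forall>v\<in>V. f (act x v) = act' x (f v)))"


section \<open>The Killing form\<close>

text \<open>
  The trace of an endomorphism of the span of the finite independent set \<open>B\<close>: the sum of the
  diagonal coefficients of its matrix in the basis \<open>B\<close>. It depends only on \<open>span B\<close>.
\<close>

definition basis_trace ::
    "('k::field \<Rightarrow> 'a::ab_group_add \<Rightarrow> 'a) \<Rightarrow> 'a set \<Rightarrow> ('a \<Rightarrow> 'a) \<Rightarrow> 'k" where
  "basis_trace s B f = (\<Sum>b\<in>B. module.representation s B (f b) b)"

definition killing_form ::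
    "('k::field \<Rightarrow> 'a::ab_group_add \<Rightarrow> 'a) \<Rightarrow> 'a set \<Rightarrow> ('a \<Rightarrow> 'a \<Rightarrow> 'a) \<Rightarrow> 'a \<Rightarrow> 'a \<Rightarrow> 'k" where
  "killing_form s B br x y = basis_trace s B (\<lambda>z. br x (br y z))"

definition orthogonal_complement :: "'a set \<Rightarrow> ('a \<Rightarrow> 'a \<Rightarrow> 'k::zero) \<Rightarrow> 'a set \<Rightarrow> 'a set" where
  "orthogonal_complement L b S = {x \<in> L. \<forall>y\<in>S. b x y = 0}"


section \<open>Reductive decompositions\<close>

definition internal_direct_sum ::
    "('k::field \<Rightarrow> 'a::ab_group_add \<Rightarrow> 'a) \<Rightarrow> 'a set \<Rightarrow> 'a set \<Rightarrow> 'a set \<Rightarrow> bool" where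
  "internal_direct_sum s V U W \<longleftrightarrow>
     module.subspace s U \<and> module.subspace s W \<and>
     V = {u + w | u w. u \<in> U \<and> w \<in> W} \<and> U \<inter> W = {0}"

text \<open>Projection onto \<open>U\<close> along \<open>W\<close>.\<close>

definition proj_along :: "'a::ab_group_add set \<Rightarrow> 'a set \<Rightarrow> 'a \<Rightarrow> 'a" where
  "proj_along U W x = (THE u. u \<in> U \<and> (\<exists>w\<in>W. x = u + w))"

definition reductive_decomposition ::
    "('k::field \<Rightarrow> 'a::ab_group_add \<Rightarrow> 'a) \<Rightarrow> 'a set \<Rightarrow> ('a \<Rightarrow> 'a \<Rightarrow> 'a) \<Rightarrow> 'a set \<Rightarrow> 'a set \<Rightarrow> bool" where
  "reductive_decomposition s G br H M \<longleftrightarrow>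
     lie_algebra s G br \<and> internal_direct_sum s G H M \<and>
     lie_subalgebra s G br H \<and> (\<forall>x\<in>H. \<forall>y\<in>M. br x y \<in> M)"

definition reductive_product ::
    "('a::ab_group_add \<Rightarrow> 'a \<Rightarrow> 'a) \<Rightarrow> 'a set \<Rightarrow> 'a set \<Rightarrow> 'a \<Rightarrow> 'a \<Rightarrow> 'a" where
  "reductive_product br H M x y = proj_along M H (br x y)"

definition reductive_triple ::
    "('a::ab_group_add \<Rightarrow> 'a \<Rightarrow> 'a) \<Rightarrow> 'a set \<Rightarrow> 'a set \<Rightarrow> 'a \<Rightarrow> 'a \<Rightarrow> 'a \<Rightarrow> 'a" where
  "reductive_triple br H M x y z = br (proj_along H M (br x y)) z"


section \<open>Lie-Yamaguti algebras\<close>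

locale lie_yamaguti_algebra = vector_space s
  for s :: "'k::field \<Rightarrow> 'a::ab_group_add \<Rightarrow> 'a" +
  fixes M :: "'a set" and m :: "'a \<Rightarrow> 'a \<Rightarrow> 'a" and T :: "'a \<Rightarrow> 'a \<Rightarrow> 'a \<Rightarrow> 'a"
  assumes subspace_carrier: "subspace M"
    and bilinear: "bilinear_on s M s M m"
    and trilinear: "trilinear_on s M T"
    and LY1: "x \<in> M \<Longrightarrow> m x x = 0"
    and LY2: "\<lbrakk>x \<in> M; y \<in> M\<rbrakk> \<Longrightarrow> T x x y = 0"
    and LY3: "\<lbrakk>x \<in> M; y \<in> M; z \<in> M\<rbrakk> \<Longrightarrow>
      (T x y z + m (m x y) z) + (T y z x + m (m y z) x) + (T z x y + m (m z x) y) = 0"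
    and LY4: "\<lbrakk>x \<in> M; y \<in> M; z \<in> M; t \<in> M\<rbrakk> \<Longrightarrow>
      T (m x y) z t + T (m y z) x t + T (m z x) y t = 0"
    and LY5: "\<lbrakk>x \<in> M; y \<in> M; u \<in> M; v \<in> M\<rbrakk> \<Longrightarrow>
      T x y (m u v) = m (T x y u) v + m u (T x y v)"
    and LY6: "\<lbrakk>x \<in> M; y \<in> M; u \<in> M; v \<in> M; w \<in> M\<rbrakk> \<Longrightarrow>
      T x y (T u v w) = T (T x y u) v w + T u (T x y v) w + T u v (T x y w)"

text \<open>
  A linear map \<open>M \<rightarrow> M\<close> is encoded by the function on the ambient type that extends it by \<open>0\<close>
  outside \<open>M\<close>, so that equality of functions is equality of maps on \<open>M\<close>. Functions and pairs
  carry the pointwise and componentwise addition of the library.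
\<close>

definition inner_derivation ::
    "'a::ab_group_add set \<Rightarrow> ('a \<Rightarrow> 'a \<Rightarrow> 'a \<Rightarrow> 'a) \<Rightarrow> 'a \<Rightarrow> 'a \<Rightarrow> 'a \<Rightarrow> 'a" where
  "inner_derivation M T x y = (\<lambda>z. if z \<in> M then T x y z else 0)"

definition fun_scale :: "('k \<Rightarrow> 'a \<Rightarrow> 'a) \<Rightarrow> 'k \<Rightarrow> ('a \<Rightarrow> 'a) \<Rightarrow> 'a \<Rightarrow> 'a" where
  "fun_scale s c f = (\<lambda>z. s c (f z))"

definition inner_derivations ::
    "('k::field \<Rightarrow> 'a::ab_group_add \<Rightarrow> 'a) \<Rightarrow> 'a set \<Rightarrow> ('a \<Rightarrow> 'a \<Rightarrow> 'a \<Rightarrow> 'a) \<Rightarrow> ('a \<Rightarrow> 'a) set" where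
  "inner_derivations s M T =
     module.span (fun_scale s) {inner_derivation M T x y | x y. x \<in> M \<and> y \<in> M}"

definition fun_commutator :: "('a::ab_group_add \<Rightarrow> 'a) \<Rightarrow> ('a \<Rightarrow> 'a) \<Rightarrow> 'a \<Rightarrow> 'a" where
  "fun_commutator f g = (\<lambda>z. f (g z) - g (f z))"

text \<open>
  The standard enveloping Lie algebra is the external direct sum of the inner derivations and
  \<open>M\<close>; the pair \<open>(d, x)\<close> stands for \<open>d + x\<close>.
\<close>

definition enveloping_carrier ::
    "('k::field \<Rightarrow> 'a::ab_group_add \<Rightarrow> 'a) \<Rightarrow> 'a set \<Rightarrow> ('a \<Rightarrow> 'a \<Rightarrow> 'a \<Rightarrow> 'a) \<Rightarrow> (('a \<Rightarrow> 'a) \<times> 'a) set" where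
  "enveloping_carrier s M T = inner_derivations s M T \<times> M"

definition enveloping_scale ::
    "('k \<Rightarrow> 'a \<Rightarrow> 'a) \<Rightarrow> 'k \<Rightarrow> ('a \<Rightarrow> 'a) \<times> 'a \<Rightarrow> ('a \<Rightarrow> 'a) \<times> 'a" where
  "enveloping_scale s c = (\<lambda>(d, x). (fun_scale s c d, s c x))"

definition enveloping_bracket ::
    "'a::ab_group_add set \<Rightarrow> ('a \<Rightarrow> 'a \<Rightarrow> 'a) \<Rightarrow> ('a \<Rightarrow> 'a \<Rightarrow> 'a \<Rightarrow> 'a) \<Rightarrow>
     ('a \<Rightarrow> 'a) \<times> 'a \<Rightarrow> ('a \<Rightarrow> 'a) \<times> 'a \<Rightarrow> ('a \<Rightarrow> 'a) \<times> 'a" where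
  "enveloping_bracket M m T = (\<lambda>(d, x) (e, y).
     (fun_commutator d e + inner_derivation M T x y, d y - e x + m x y))"

end

theory Submission
  imports Defs
begin

text \<open>
  The isomorphisms hold because a simple Lie algebra \<open>\<gg>\<close> has no room for proper ideals.
  The sum of \<open>M\<close> and the span of the \<open>H\<close>-parts of the brackets of elements of \<open>M\<close> is an ideal
  containing \<open>M \<noteq> 0\<close>, so those \<open>H\<close>-parts span \<open>H\<close> (\<open>span_pH_brackets\<close>). The annihilator of \<open>M\<close>
  in \<open>H\<close> is an ideal too, and it is not everything, so \<open>H\<close> acts faithfully on \<open>M\<close> (\<open>faithful\<close>).
  Hence sending \<open>a \<in> H\<close> to its action on \<open>M\<close> is a bijection of \<open>H\<close> onto the inner derivations, and
  adding the identity of \<open>M\<close> gives a bijection of \<open>\<gg>\<close> onto the enveloping algebra. Both respect the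
  brackets, so the targets inherit the Lie algebra axioms (\<open>lie_algebra_transport\<close>).

  For the alternative, let \<open>H\<close> be semisimple and \<open>M\<close> irreducible, and suppose that \<open>M\<close> is not
  orthogonal to \<open>H\<close> for the Killing form of \<open>\<gg>\<close>. This form is nondegenerate on \<open>H\<close>, so there is an
  orthogonal projection \<open>\<gg> \<rightarrow> H\<close>; it commutes with the action of \<open>H\<close> and is not zero on \<open>M\<close>, hence it
  is injective there by irreducibility, and its image \<open>I\<close> is an ideal of \<open>H\<close>. The orthogonal
  complement \<open>J\<close> of \<open>I\<close> in \<open>H\<close> satisfies \<open>[J, I] \<subseteq> J \<inter> I = 0\<close>, since the form is nondegenerate on \<open>I\<close> as
  well. So \<open>J\<close> kills \<open>I \<cong> M\<close>, and \<open>J = 0\<close> by faithfulness. Thus \<open>I = H\<close>, and \<open>M \<cong> H\<close>.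

  The substance is the nondegeneracy on ideals of \<open>H\<close>, a form of Cartan's criterion
  (\<open>isotropic_ideal_zero\<close>). Let \<open>R\<close> be an ideal of \<open>H\<close> on which the Killing form of \<open>\<gg>\<close> vanishes, and
  \<open>x\<close> a sum of brackets of elements of \<open>R\<close>. Let \<open>\<gg>\<^sub>a\<close> be the generalised eigenspace of \<open>ad x\<close> for \<open>a\<close>.
  For every additive \<open>q\<close> from the field to the rationals, the map \<open>D\<close> that is \<open>q a\<close> on \<open>\<gg>\<^sub>a\<close> is a
  derivation, because \<open>[\<gg>\<^sub>a, \<gg>\<^sub>b] \<subseteq> \<gg>\<^bsub>a+b\<^esub>\<close>, and it preserves \<open>R\<close>, because \<open>R\<close> is stable under \<open>ad x\<close>. From
  \<open>tr (ad [a, b] D) = - tr (ad a ad (D b)) = 0\<close> it follows that \<open>tr (ad x D) = 0\<close>, that is, the sum of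
  \<open>a q(a)\<close> over the eigenvalues \<open>a\<close> is \<open>0\<close>. Applying \<open>q\<close> gives a vanishing sum of rational squares, so
  all \<open>q(a)\<close> vanish; as \<open>q\<close> was arbitrary, \<open>ad x\<close> is nilpotent. By Engel's theorem \<open>[R, R]\<close>, if not
  zero, has a nonzero centre, which would be an abelian ideal of \<open>H\<close>. So \<open>R\<close> is abelian, and \<open>R = 0\<close>.
\<close>

section \<open>Generalised eigenspaces\<close>

locale endomorphism = finite_dimensional_vector_space scale Basis
  for scale :: "'k::field \<Rightarrow> 'v::ab_group_add \<Rightarrow> 'v" (infixr \<open>*s\<close> 75) and Basis +
  fixes T :: "'v \<Rightarrow> 'v"
  assumes T_add: "T (u + v) = T u + T v"
    and T_scale: "T (c *s v) = c *s T v"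
begin

lemma T_0 [simp]: "T 0 = 0"
  using T_scale[of 0 0] by simp

lemma T_diff: "T (u - v) = T u - T v"
  using T_add[of "u - v" v] by (simp add: algebra_simps)

lemma T_sum: "T (\<Sum>i\<in>I. f i) = (\<Sum>i\<in>I. T (f i))"
  by (induction I rule: infinite_finite_induct) (simp_all add: T_add)

definition stable :: "'v set \<Rightarrow> bool" where
  "stable U \<longleftrightarrow> subspace U \<and> (\<forall>u\<in>U. T u \<in> U)"

text \<open>
  The value at \<open>v\<close> of the polynomial \<open>p\<close> in \<open>T\<close>, evaluated by Horner's scheme.
\<close>

definition poly_apply :: "'k poly \<Rightarrow> 'v \<Rightarrow> 'v" where
  "poly_apply p v = fold_coeffs (\<lambda>a w. a *s v + T w) p 0"

lemma poly_apply_0 [simp]: "poly_apply 0 v = 0"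
  by (simp add: poly_apply_def)

lemma poly_apply_pCons [simp]: "poly_apply (pCons a p) v = a *s v + T (poly_apply p v)"
  by (cases "p = 0 \<and> a = 0") (auto simp: poly_apply_def)

lemma poly_apply_add: "poly_apply (p + q) v = poly_apply p v + poly_apply q v"
  by (induction p q rule: poly_induct2) (simp_all add: T_add scale_left_distrib algebra_simps)

lemma poly_apply_smult: "poly_apply (smult c p) v = c *s poly_apply p v"
  by (induction p) (simp_all add: T_scale scale_right_distrib)

lemma poly_apply_monom: "poly_apply (monom 1 n) v = (T ^^ n) v"
  by (induction n) (simp_all add: monom_0 monom_Suc)

lemma poly_apply_linear_factor:
  "poly_apply ([:- a, 1:] * q) v = T (poly_apply q v) - a *s poly_apply q v"
proof -
  have "[:- a, 1:] * q = pCons 0 q + smult (- a) q" by simp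
  then show ?thesis by (simp only: poly_apply_add poly_apply_smult poly_apply_pCons) simp
qed

lemma poly_apply_stable: "stable U \<Longrightarrow> v \<in> U \<Longrightarrow> poly_apply p v \<in> U"
  by (induction p) (auto simp: stable_def intro: subspace_0 subspace_add subspace_scale)

text \<open>
  Some power of \<open>T\<close> sends \<open>v\<close> into the span of the images of \<open>v\<close> under the lower powers, since
  otherwise these images would be independent in any number.
\<close>

lemma annihilating_poly_exists:
  obtains p where "p \<noteq> 0" "poly_apply p v = 0"
proof -
  let ?S = "\<lambda>n. (\<lambda>i. (T ^^ i) v) ` {..<n}"
  \<comment> \<open>otherwise there would be more independent vectors than the dimension allows\<close>
  have "\<exists>n. (T ^^ n) v \<in> span (?S n)"
  proof (rule ccontr)
    assume "\<not> ?thesis"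
    then have new: "(T ^^ n) v \<notin> span (?S n)" for n by blast
    have "independent (?S n) \<and> card (?S n) = n" for n
    proof (induction n)
      case (Suc n)
      have "(T ^^ n) v \<notin> ?S n" using new[of n] span_superset[of "?S n"] by blast
      then show ?case
        using Suc independent_insertI[OF new] by (simp add: lessThan_Suc)
    qed (simp add: independent_empty)
    then have "Suc dimension \<le> dim UNIV"
      using independent_card_le_dim[of _ UNIV] by (metis subset_UNIV)
    then show False by (simp add: dimension_def)
  qed
  then obtain n where n: "(T ^^ n) v \<in> span (?S n)" by blast
  let ?P = "{poly_apply p v | p. \<forall>i\<ge>n. coeff p i = 0}"
  have "subspace ?P"
  proof (rule subspaceI)
    show "0 \<in> ?P" by (auto intro!: exI[of _ 0])
    show "x + y \<in> ?P" if "x \<in> ?P" "y \<in> ?P" for x y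
    proof -
      from that obtain p q where "x = poly_apply p v" "y = poly_apply q v"
        "\<forall>i\<ge>n. coeff p i = 0" "\<forall>i\<ge>n. coeff q i = 0" by blast
      then show ?thesis by (auto simp: poly_apply_add intro!: exI[of _ "p + q"])
    qed
    show "c *s x \<in> ?P" if "x \<in> ?P" for c x
    proof -
      from that obtain p where "x = poly_apply p v" "\<forall>i\<ge>n. coeff p i = 0" by blast
      then show ?thesis by (auto simp: poly_apply_smult intro!: exI[of _ "smult c p"])
    qed
  qed
  moreover have "?S n \<subseteq> ?P"
    by (force simp flip: poly_apply_monom)
  ultimately have "span (?S n) \<subseteq> ?P" by (rule span_minimal[rotated])
  with n obtain p where p: "(T ^^ n) v = poly_apply p v" "\<forall>i\<ge>n. coeff p i = 0" by blast
  \<comment> \<open>the coefficient at \<open>n\<close> keeps \<open>?q\<close> from vanishing, even if \<open>n = 0\<close>\<close>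
  let ?q = "monom 1 n + smult (- 1) p"
  have "coeff ?q n = 1" using p by simp
  then have "?q \<noteq> 0" by (metis coeff_0 zero_neq_one)
  moreover have "poly_apply ?q v = 0"
    unfolding poly_apply_add poly_apply_smult poly_apply_monom using p by simp
  ultimately show thesis by (rule that)
qed

text \<open>
  The union of the kernels of the powers of \<open>T - a\<close>, in inductive form, so that an induction over
  the nilpotency index needs no exponents.
\<close>

inductive_set gen_eigenspace :: "'k \<Rightarrow> 'v set" for a where
  zero: "0 \<in> gen_eigenspace a"
| step: "T v - a *s v \<in> gen_eigenspace a \<Longrightarrow> v \<in> gen_eigenspace a"

lemma gen_eigenspace_shift:
  assumes "v \<in> gen_eigenspace a" shows "T v - a *s v \<in> gen_eigenspace a"
  using assms by cases (simp_all add: gen_eigenspace.zero)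

lemma subspace_gen_eigenspace: "subspace (gen_eigenspace a)"
proof (rule subspaceI)
  show "0 \<in> gen_eigenspace a" by (rule gen_eigenspace.zero)
  show "u + v \<in> gen_eigenspace a" if "u \<in> gen_eigenspace a" "v \<in> gen_eigenspace a" for u v
    using that
  proof (induction arbitrary: v)
    case (step u)
    then have "(T u - a *s u) + (T v - a *s v) \<in> gen_eigenspace a"
      using gen_eigenspace_shift by blast
    then show ?case
      by - (rule gen_eigenspace.step, simp add: T_add scale_right_distrib algebra_simps)
  qed simp
  show "c *s v \<in> gen_eigenspace a" if "v \<in> gen_eigenspace a" for c v
    using that
  proof induction
    case (step v)
    then show ?case
      by - (rule gen_eigenspace.step, simp add: T_scale scale_right_diff_distrib mult.commute)
  qed (simp add: gen_eigenspace.zero)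
qed

lemma T_gen_eigenspace:
  assumes "v \<in> gen_eigenspace a" shows "T v \<in> gen_eigenspace a"
proof -
  have "(T v - a *s v) + a *s v \<in> gen_eigenspace a"
    using assms gen_eigenspace_shift subspace_gen_eigenspace subspace_add subspace_scale by meson
  then show ?thesis by simp
qed

lemma gen_eigenspace_shift_other:
  assumes "v \<in> gen_eigenspace a" shows "T v - c *s v \<in> gen_eigenspace a"
  using assms subspace_gen_eigenspace by (blast intro: subspace_diff subspace_scale T_gen_eigenspace)

text \<open>
  On an eigenvector for \<open>c\<close>, the map \<open>T - a\<close> is multiplication by \<open>c - a \<noteq> 0\<close>, so it never dies out.
\<close>

lemma eigenvector_gen_eigenspace:
  assumes "v \<in> gen_eigenspace a" "T v = c *s v" "c \<noteq> a"
  shows "v = 0"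
  using assms
proof induction
  case (step v)
  have "T v - a *s v = (c - a) *s v" using step.prems by (simp add: scale_left_diff_distrib)
  moreover have "T (T v - a *s v) = c *s (T v - a *s v)"
    using step.prems by (simp add: T_diff T_scale scale_right_diff_distrib mult.commute)
  ultimately show ?case using step by auto
qed simp

text \<open>
  Let \<open>u\<close> be one of the vectors, in the generalised eigenspace for \<open>a\<close>. Applying \<open>T - a\<close> to the
  relation shortens the way of \<open>u\<close> to zero, so by induction \<open>T - a\<close> kills all the vectors. The others
  then are eigenvectors for \<open>a\<close> in generalised eigenspaces for other values, hence zero.
\<close>

lemma gen_eigenspaces_independent:
  assumes "finite F" "\<And>c. c \<in> F \<Longrightarrow> v c \<in> gen_eigenspace c" "(\<Sum>c\<in>F. v c) = 0" "c \<in> F"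
  shows "v c = 0"
  using assms
proof (induction F arbitrary: v c)
  case (insert a F)
  have all_zero: "u = 0 \<and> (\<forall>c\<in>F. w c = 0)"
    if "u \<in> gen_eigenspace a" "\<forall>c\<in>F. w c \<in> gen_eigenspace c" "u + (\<Sum>c\<in>F. w c) = 0" for u w
    using that
  proof (induction arbitrary: w)
    case zero
    have "w c = 0" if "c \<in> F" for c
    proof (rule insert.IH)
      show "w b \<in> gen_eigenspace b" if "b \<in> F" for b using zero(1) that by blast
      show "sum w F = 0" using zero(2) by simp
    qed (fact that)
    then show ?case by simp
  next
    case (step u)
    let ?w = "\<lambda>c. T (w c) - a *s w c"
    have "\<forall>c\<in>F. ?w c \<in> gen_eigenspace c"
      using step.prems(1) gen_eigenspace_shift_other by blast
    moreover have "(T u - a *s u) + (\<Sum>c\<in>F. ?w c) = T (u + (\<Sum>c\<in>F. w c)) - a *s (u + (\<Sum>c\<in>F. w c))"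
      by (simp add: T_add T_sum scale_right_distrib sum_subtractf scale_sum_right)
    ultimately have zero: "T u - a *s u = 0 \<and> (\<forall>c\<in>F. ?w c = 0)"
      using step.IH[of ?w] step.prems(2) by simp
    have "w c = 0" if "c \<in> F" for c
    proof (rule eigenvector_gen_eigenspace)
      show "w c \<in> gen_eigenspace c" using step.prems(1) that by blast
      show "T (w c) = a *s w c" using zero that by simp
      show "a \<noteq> c" using that insert.hyps by blast
    qed
    then show ?case using step.prems(2) by simp
  qed
  have "v a = 0 \<and> (\<forall>c\<in>F. v c = 0)"
  proof (rule all_zero)
    show "v a \<in> gen_eigenspace a" using insert.prems(1) by blast
    show "\<forall>c\<in>F. v c \<in> gen_eigenspace c" using insert.prems(1) by blast
    show "v a + sum v F = 0" using insert.prems(2) insert.hyps by simp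
  qed
  then show ?case using insert.prems(3) by blast
qed simp

end

locale alg_closed_endomorphism = endomorphism scale Basis T
  for scale :: "'k::alg_closed_field \<Rightarrow> 'v::ab_group_add \<Rightarrow> 'v" (infixr \<open>*s\<close> 75) and Basis T
begin

text \<open>
  An eigenvector of the map induced on \<open>U / S\<close>. Among the polynomials in \<open>T\<close> that send \<open>u\<close> into \<open>S\<close>
  take one of least degree; splitting off a linear factor leaves one that does not send \<open>u\<close> into \<open>S\<close>.
\<close>

lemma relative_eigenvector:
  assumes S: "stable S" and U: "stable U" and u: "u \<in> U" "u \<notin> S"
  obtains v a where "v \<in> U" "v \<notin> S" "T v - a *s v \<in> S"
proof -
  obtain p where "p \<noteq> 0" "poly_apply p u \<in> S"
    using annihilating_poly_exists[of u] S subspace_0 unfolding stable_def by metis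
  then obtain p where p: "p \<noteq> 0" "poly_apply p u \<in> S"
    and min: "\<And>q. q \<noteq> 0 \<Longrightarrow> poly_apply q u \<in> S \<Longrightarrow> degree p \<le> degree q"
    using exists_least_iff[of "\<lambda>n. \<exists>p. p \<noteq> 0 \<and> poly_apply p u \<in> S \<and> degree p = n"]
    by (metis not_le)
  have "degree p > 0"
  proof (rule ccontr)
    assume "\<not> degree p > 0"
    then obtain c where c: "p = [:c:]" using degree_eq_zeroE by blast
    then have "inverse c *s (c *s u) \<in> S"
      using p S subspace_scale unfolding stable_def by fastforce
    with u c p show False by simp
  qed
  then obtain a where "poly p a = 0"
    using alg_closed_imp_poly_has_root[of p] by blast
  then obtain q where q: "p = [:- a, 1:] * q"
    using poly_eq_0_iff_dvd by blast
  have "q \<noteq> 0" using q p by auto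
  then have "degree p = Suc (degree q)" using q by (simp add: degree_mult_eq del: mult_pCons_left)
  then have "poly_apply q u \<notin> S" using min[of q] \<open>q \<noteq> 0\<close> by auto
  moreover have "T (poly_apply q u) - a *s poly_apply q u \<in> S"
    using p(2) unfolding q poly_apply_linear_factor .
  ultimately show thesis using that[of "poly_apply q u" a] poly_apply_stable[OF U u(1)] by blast
qed

text \<open>
  On the generalised eigenspace for \<open>b\<close>, the map \<open>T - a\<close> is the sum of the nonzero scalar \<open>b - a\<close> and a
  nilpotent map, hence invertible.
\<close>

lemma shift_surj_gen_eigenspace:
  assumes U: "stable U" and "v \<in> gen_eigenspace b" "v \<in> U" "a \<noteq> b"
  shows "\<exists>u \<in> U \<inter> gen_eigenspace b. T u - a *s u = v"
  using assms(2,3)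
proof induction
  case zero
  then show ?case using U gen_eigenspace.zero by (auto intro!: bexI[of _ 0])
next
  case (step v)
  have "T v - b *s v \<in> U" using U step.prems by (auto simp: stable_def intro: subspace_diff subspace_scale)
  then obtain u where u: "u \<in> U" "u \<in> gen_eigenspace b" "T u - a *s u = T v - b *s v"
    using step.IH by auto
  \<comment> \<open>from \<open>(b - a) v = (T - a) v - (T - b) v\<close> and \<open>(T - b) v = (T - a) u\<close>\<close>
  let ?w = "inverse (b - a) *s (v - u)"
  have "v \<in> gen_eigenspace b" using step.hyps by (rule gen_eigenspace.step)
  then have "?w \<in> U \<inter> gen_eigenspace b"
    using U u step.prems subspace_gen_eigenspace[of b]
    by (auto simp: stable_def intro!: subspace_diff subspace_scale)
  have "T (v - u) - a *s (v - u) = (b - a) *s v"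
    using u(3) by (simp add: T_diff scale_right_diff_distrib scale_left_diff_distrib algebra_simps)
  moreover have "T ?w - a *s ?w = inverse (b - a) *s (T (v - u) - a *s (v - u))"
    unfolding T_scale scale_left_commute[of a] by (simp only: scale_right_diff_distrib)
  ultimately have "T ?w - a *s ?w = v"
    using \<open>a \<noteq> b\<close> by simp
  with \<open>?w \<in> U \<inter> gen_eigenspace b\<close> show ?case by blast
qed

text \<open>
  Stable subspaces inherit the decomposition into generalised eigenspaces. If the span \<open>S\<close> of those
  inside \<open>U\<close> were proper, there would be an eigenvector \<open>v\<close> modulo \<open>S\<close>, for \<open>a\<close> say. As \<open>T - a\<close> maps
  \<open>S\<close> onto \<open>S\<close> up to the generalised eigenspace for \<open>a\<close>, subtracting a suitable \<open>u \<in> S\<close> moves \<open>v\<close>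
  into that eigenspace, so \<open>v \<in> S\<close> after all.
\<close>

lemma stable_span_gen_eigenspaces:
  assumes U: "stable U"
  shows "span (\<Union>a. U \<inter> gen_eigenspace a) = U"
proof -
  let ?S = "span (\<Union>a. U \<inter> gen_eigenspace a)"
  have sub: "?S \<subseteq> U" using U by (intro span_minimal) (auto simp: stable_def)
  have inS: "v \<in> ?S" if "v \<in> U" "v \<in> gen_eigenspace a" for v a
    using that by (auto intro: span_base)
  have "T v \<in> ?S" if "v \<in> ?S" for v
    using that
  proof (induction rule: span_induct)
    case base
    show ?case by (auto intro!: subspaceI simp: T_add T_scale span_zero span_add span_scale)
  next
    case (step x)
    then obtain a where "x \<in> U" "x \<in> gen_eigenspace a" by blast
    then have "T x \<in> ?S" using U T_gen_eigenspace by (intro inS[of _ a]) (auto simp: stable_def)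
    then show ?case by simp
  qed
  then have "stable ?S" by (auto simp: stable_def)
  have "U \<subseteq> ?S"
  proof (rule ccontr)
    assume "\<not> U \<subseteq> ?S"
    then obtain v a where v: "v \<in> U" "v \<notin> ?S" "T v - a *s v \<in> ?S"
      using relative_eigenvector[OF \<open>stable ?S\<close> U] by blast
    have "\<exists>u\<in>?S. T u - a *s u - w \<in> U \<inter> gen_eigenspace a" if "w \<in> ?S" for w
      using that
    proof (induction rule: span_induct)
      case base
      show ?case
      proof (rule subspaceI)
        show "0 \<in> {w. \<exists>u\<in>?S. T u - a *s u - w \<in> U \<inter> gen_eigenspace a}"
          using U gen_eigenspace.zero by (auto simp: stable_def intro!: bexI[of _ 0] subspace_0 span_zero)
      next
        fix x y
        assume "x \<in> {w. \<exists>u\<in>?S. T u - a *s u - w \<in> U \<inter> gen_eigenspace a}"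
          "y \<in> {w. \<exists>u\<in>?S. T u - a *s u - w \<in> U \<inter> gen_eigenspace a}"
        then obtain u v where uv: "u \<in> ?S" "v \<in> ?S" "T u - a *s u - x \<in> U \<inter> gen_eigenspace a"
          "T v - a *s v - y \<in> U \<inter> gen_eigenspace a" by blast
        have "(T u - a *s u - x) + (T v - a *s v - y) \<in> U \<inter> gen_eigenspace a"
          using uv U subspace_gen_eigenspace by (auto simp: stable_def intro: subspace_add)
        then have "T (u + v) - a *s (u + v) - (x + y) \<in> U \<inter> gen_eigenspace a"
          by (simp add: T_add scale_right_distrib algebra_simps)
        then show "x + y \<in> {w. \<exists>u\<in>?S. T u - a *s u - w \<in> U \<inter> gen_eigenspace a}"
          using uv span_add by blast
      next
        fix c x
        assume "x \<in> {w. \<exists>u\<in>?S. T u - a *s u - w \<in> U \<inter> gen_eigenspace a}"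
        then obtain u where u: "u \<in> ?S" "T u - a *s u - x \<in> U \<inter> gen_eigenspace a" by blast
        have "c *s (T u - a *s u - x) \<in> U \<inter> gen_eigenspace a"
          using u U subspace_gen_eigenspace by (auto simp: stable_def intro: subspace_scale)
        then have "T (c *s u) - a *s (c *s u) - c *s x \<in> U \<inter> gen_eigenspace a"
          by (simp add: T_scale scale_right_diff_distrib mult.commute)
        then show "c *s x \<in> {w. \<exists>u\<in>?S. T u - a *s u - w \<in> U \<inter> gen_eigenspace a}"
          using u span_scale by blast
      qed
    next
      case (step w)
      then obtain b where b: "w \<in> U" "w \<in> gen_eigenspace b" by blast
      show ?case
      proof (cases "a = b")
        case True
        then show ?thesis using b U subspace_gen_eigenspace
          by (auto simp: stable_def subspace_neg intro!: bexI[of _ 0] span_zero)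
      next
        case False
        then obtain u where u: "u \<in> U" "u \<in> gen_eigenspace b" "T u - a *s u = w"
          using shift_surj_gen_eigenspace[OF U b(2,1)] by blast
        have "T u - a *s u - w \<in> U \<inter> gen_eigenspace a"
          using u U gen_eigenspace.zero by (simp add: stable_def subspace_0)
        then show ?thesis using inS[OF u(1,2)] by blast
      qed
    qed
    then obtain u where u: "u \<in> ?S" "T u - a *s u - (T v - a *s v) \<in> U \<inter> gen_eigenspace a"
      using v(3) by blast
    have "T (u - v) - a *s (u - v) \<in> gen_eigenspace a"
      using u(2) by (simp add: T_diff scale_right_diff_distrib algebra_simps)
    then have "u - v \<in> U \<inter> gen_eigenspace a"
      using u(1) sub v(1) U gen_eigenspace.step[of "u - v" a]
      by (auto simp: stable_def intro!: subspace_diff)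
    then have "u - v \<in> ?S" using inS[of "u - v" a] by blast
    then have "u - (u - v) \<in> ?S" by (rule span_diff[OF u(1)])
    with v(2) show False by simp
  qed
  with sub show ?thesis by blast
qed

text \<open>
  A basis which is adapted to the generalised eigenspaces and triangularises \<open>T\<close>, built by adding
  vectors that are eigenvectors modulo the span of the previous ones. Of triangularity it records
  only that \<open>w b\<close> is the diagonal coefficient of \<open>T\<close> at \<open>b\<close>, which is what a trace sees.
\<close>

lemma triangular_eigenbasis:
  obtains B w where "independent B" "span B = UNIV"
    "\<And>b. b \<in> B \<Longrightarrow> b \<in> gen_eigenspace (w b)"
    "\<And>b. b \<in> B \<Longrightarrow> T b - w b *s b \<in> span (B - {b})"
proof -
  let ?tri = "\<lambda>B. independent B \<and>
    (\<forall>b\<in>B. \<exists>a. b \<in> gen_eigenspace a \<and> T b - a *s b \<in> span (B - {b}))"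
  have "?tri {}" by (simp add: independent_empty)
  moreover have "\<forall>B. ?tri B \<longrightarrow> card B < Suc (dim UNIV)"
    using independent_card_le_dim[OF subset_UNIV] by (simp add: less_Suc_eq_le)
  ultimately obtain B where tri: "?tri B" and max: "\<And>B'. ?tri B' \<Longrightarrow> card B' \<le> card B"
    using ex_has_greatest_nat[of ?tri "{}" card "Suc (dim UNIV)"] by blast
  have "span B = UNIV"
  proof (rule ccontr)
    assume "span B \<noteq> UNIV"
    have "span (\<Union>a. UNIV \<inter> gen_eigenspace a) = UNIV"
      by (rule stable_span_gen_eigenspaces) (simp add: stable_def)
    then have "\<not> (\<Union>a. gen_eigenspace a) \<subseteq> span B"
      using \<open>span B \<noteq> UNIV\<close> span_minimal[of "\<Union>a. gen_eigenspace a" "span B"] by auto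
    then obtain u a where u: "u \<in> gen_eigenspace a" "u \<notin> span B" by blast
    then have "\<exists>v. v \<in> gen_eigenspace a \<and> v \<notin> span B \<and> T v - a *s v \<in> span B"
    proof induction
      case zero
      then show ?case using span_zero by blast
    next
      case (step v)
      then show ?case using gen_eigenspace.step by blast
    qed
    then obtain v where v: "v \<in> gen_eigenspace a" "v \<notin> span B" "T v - a *s v \<in> span B" by blast
    have "v \<notin> B" using v span_base by blast
    have mono: "span (B - {b}) \<subseteq> span (insert v B - {b})" for b by (rule span_mono) blast
    have "?tri (insert v B)"
    proof (intro conjI ballI)
      show "independent (insert v B)" using tri independent_insertI[OF v(2)] by blast
      show "\<exists>a. b \<in> gen_eigenspace a \<and> T b - a *s b \<in> span (insert v B - {b})"
        if "b \<in> insert v B" for b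
      proof (cases "b = v")
        case True
        have "insert v B - {v} = B" using \<open>v \<notin> B\<close> by auto
        then show ?thesis using v True by auto
      next
        case False
        then show ?thesis using tri mono that by blast
      qed
    qed
    then have "card (insert v B) \<le> card B" by (rule max)
    then show False using \<open>v \<notin> B\<close> tri finiteI_independent by auto
  qed
  moreover obtain w where "\<forall>b\<in>B. b \<in> gen_eigenspace (w b) \<and> T b - w b *s b \<in> span (B - {b})"
    using tri bchoice[of B] by meson
  ultimately show thesis using that[of B w] tri by blast
qed

end

section \<open>Traces\<close>

context finite_dimensional_vector_space
begin

abbreviation linear_endo :: "('b \<Rightarrow> 'b) \<Rightarrow> bool" where
  "linear_endo f \<equiv> Vector_Spaces.linear scale scale f"

lemma linear_endoI:
  assumes "\<And>u v. f (u + v) = f u + f v" "\<And>c v. f (scale c v) = scale c (f v)"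
  shows "linear_endo f"
  using assms vector_space_axioms unfolding Vector_Spaces.linear_iff by blast

lemma linear_endoD:
  assumes "linear_endo f"
  shows "f (u + v) = f u + f v" "f (scale c v) = scale c (f v)"
  using assms unfolding Vector_Spaces.linear_iff by blast+

lemma linear_endo_sum:
  assumes "linear_endo f" shows "f (\<Sum>i\<in>I. g i) = (\<Sum>i\<in>I. f (g i))"
  using assms module_hom.sum module_hom_linearI by blast

lemma representation_linear_endo:
  assumes f: "linear_endo f" and B: "independent B" "span B = UNIV"
    and C: "independent C" "span C = UNIV"
  shows "representation B (f v) b = (\<Sum>c\<in>C. representation C v c * representation B (f c) b)"
proof -
  have "v = (\<Sum>c\<in>C. scale (representation C v c) c)"
    using C finiteI_independent[OF C(1)] by (simp add: sum_representation_eq)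
  then have "f v = (\<Sum>c\<in>C. scale (representation C v c) (f c))"
    by (metis (no_types, lifting) linear_endo_sum[OF f] linear_endoD(2)[OF f] sum.cong)
  then show ?thesis
    using B by (simp add: representation_sum representation_scale)
qed

text \<open>
  The usual \<open>tr (f g) = tr (g f)\<close>, with two bases: for equal bases it is the cyclic property, and for
  \<open>g = id\<close> it is the independence of the trace from the basis.
\<close>

lemma basis_trace_compose_commute:
  assumes f: "linear_endo f" and g: "linear_endo g"
    and B: "independent B" "span B = UNIV" and C: "independent C" "span C = UNIV"
  shows "basis_trace scale B (\<lambda>v. f (g v)) = basis_trace scale C (\<lambda>v. g (f v))"
proof -
  have "basis_trace scale B (\<lambda>v. f (g v))
    = (\<Sum>b\<in>B. \<Sum>c\<in>C. representation C (g b) c * representation B (f c) b)"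
    unfolding basis_trace_def by (intro sum.cong refl representation_linear_endo[OF f B C])
  also have "\<dots> = (\<Sum>c\<in>C. \<Sum>b\<in>B. representation B (f c) b * representation C (g b) c)"
    by (subst sum.swap) (simp add: mult.commute)
  also have "\<dots> = basis_trace scale C (\<lambda>v. g (f v))"
    unfolding basis_trace_def by (intro sum.cong refl representation_linear_endo[OF g C B, symmetric])
  finally show ?thesis .
qed

abbreviation tr :: "('b \<Rightarrow> 'b) \<Rightarrow> 'a" where
  "tr \<equiv> basis_trace scale Basis"

lemma tr_compose_commute:
  "linear_endo f \<Longrightarrow> linear_endo g \<Longrightarrow> tr (\<lambda>v. f (g v)) = tr (\<lambda>v. g (f v))"
  using basis_trace_compose_commute independent_Basis span_Basis by blast

lemma tr_basis:
  assumes "independent B" "span B = UNIV" "linear_endo f"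
  shows "tr f = basis_trace scale B f"
  using basis_trace_compose_commute[OF assms(3) linear_ident independent_Basis span_Basis assms(1,2)]
  by simp

lemma tr_0 [simp]: "tr (\<lambda>v. 0) = 0"
  unfolding basis_trace_def by (simp add: representation_zero)

lemma tr_add: "tr (\<lambda>v. f v + g v) = tr f + tr g"
  unfolding basis_trace_def
  by (simp add: representation_add independent_Basis span_Basis sum.distrib)

lemma tr_diff: "tr (\<lambda>v. f v - g v) = tr f - tr g"
  unfolding basis_trace_def
  by (simp add: representation_diff independent_Basis span_Basis sum_subtractf)

lemma tr_scale: "tr (\<lambda>v. scale c (f v)) = c * tr f"
  unfolding basis_trace_def
  by (simp add: representation_scale independent_Basis span_Basis sum_distrib_left)

end

section \<open>Additive functions of the eigenvalues\<close>

context alg_closed_endomorphism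
begin

text \<open>
  Prescribe \<open>D\<close> on a basis of generalised eigenvectors. It is then right on every \<open>v\<close> in the
  generalised eigenspace for \<open>a\<close>, because by independence only basis vectors for the same \<open>a\<close>
  contribute to \<open>v\<close>.
\<close>

lemma weight_map_exists:
  fixes f :: "'k \<Rightarrow> 'k"
  obtains D where "linear_endo D" "\<And>a v. v \<in> gen_eigenspace a \<Longrightarrow> D v = f a *s v"
proof -
  obtain B w where B: "independent B" "span B = UNIV"
    and w: "\<And>b. b \<in> B \<Longrightarrow> b \<in> gen_eigenspace (w b)"
    by (rule triangular_eigenbasis) blast
  have "finite B" using B(1) by (rule finiteI_independent)
  interpret vector_space_pair scale scale ..
  obtain D where D: "linear_endo D" and DB: "\<And>b. b \<in> B \<Longrightarrow> D b = f (w b) *s b"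
    using linear_independent_extend[OF B(1), of "\<lambda>b. f (w b) *s b"] by blast
  have "D v = f a *s v" if v: "v \<in> gen_eigenspace a" for a v
  proof -
    let ?r = "representation B v"
    \<comment> \<open>the component of \<open>v\<close> for \<open>c\<close>; subtracting \<open>v\<close> from the one for \<open>a\<close> gives a vanishing sum\<close>
    let ?part = "\<lambda>c. \<Sum>b | b \<in> B \<and> w b = c. ?r b *s b"
    let ?F = "insert a (w ` B)"
    let ?u = "\<lambda>c. ?part c - (if c = a then v else 0)"
    have "v = (\<Sum>b\<in>B. ?r b *s b)"
      using B \<open>finite B\<close> by (simp add: sum_representation_eq)
    also have "\<dots> = (\<Sum>c\<in>?F. ?part c)"
      by (rule sum.group[symmetric]) (use \<open>finite B\<close> in auto)
    finally have "(\<Sum>c\<in>?F. ?u c) = 0"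
      using \<open>finite B\<close> by (simp add: sum_subtractf sum.delta del: sum.insert)
    moreover have "?u c \<in> gen_eigenspace c" for c
      using v w subspace_gen_eigenspace
      by (intro subspace_diff subspace_sum) (auto intro: subspace_scale gen_eigenspace.zero)
    ultimately have "?u a = 0"
      using \<open>finite B\<close> gen_eigenspaces_independent[of ?F ?u a] by blast
    then have part: "v = ?part a" by simp
    have "D (?part a) = (\<Sum>b | b \<in> B \<and> w b = a. f a *s (?r b *s b))"
      unfolding linear_endo_sum[OF D]
      by (rule sum.cong) (auto simp: linear_endoD(2)[OF D] DB mult.commute)
    also have "\<dots> = f a *s ?part a" by (simp only: scale_sum_right)
    finally show ?thesis using part by simp
  qed
  with D show thesis by (rule that)
qed

end

text \<open>
  Extend \<open>{a}\<close> to a basis of the field as a vector space over \<open>\<rat>\<close>.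
\<close>

lemma rational_functional_exists:
  fixes a :: "'k::field_char_0"
  assumes "a \<noteq> 0"
  obtains q :: "'k \<Rightarrow> rat" where "q a \<noteq> 0" "\<And>x y. q (x + y) = q x + q y"
    "\<And>r x. q (of_rat r * x) = r * q x"
proof -
  interpret vector_space_pair "\<lambda>r (x::'k). of_rat r * x" "(*) :: rat \<Rightarrow> rat \<Rightarrow> rat"
    by unfold_locales (auto simp: algebra_simps of_rat_add of_rat_mult)
  have "vs1.independent {a}" using assms by simp
  then obtain q where q: "Vector_Spaces.linear (\<lambda>r x. of_rat r * x) (*) q" "q a = 1"
    using linear_independent_extend[of "{a}" "\<lambda>_. 1"] by auto
  then show thesis
    using that[of q] unfolding Vector_Spaces.linear_iff by auto
qed

locale char_0_endomorphism = alg_closed_endomorphism scale Basis T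
  for scale :: "'k::{alg_closed_field, field_char_0} \<Rightarrow> 'v::ab_group_add \<Rightarrow> 'v" (infixr \<open>*s\<close> 75)
    and Basis T
begin

text \<open>
  The trace of \<open>T D\<close> is the sum of \<open>q(a) a\<close> over the eigenvalues \<open>a\<close> with multiplicity. If it
  vanishes, then so does its image under \<open>q\<close>, which is the sum of the squares of the rational
  numbers \<open>q(a)\<close>. If some eigenvalue were not \<open>0\<close>, some \<open>q\<close> would not vanish at it.
\<close>

lemma nilpotent_if_weight_traces_vanish:
  assumes vanish: "\<And>D q. \<lbrakk>linear_endo D; \<And>a b. q (a + b) = q a + q b;
      \<And>a v. v \<in> gen_eigenspace a \<Longrightarrow> D v = of_rat (q a) *s v\<rbrakk> \<Longrightarrow> tr (\<lambda>v. T (D v)) = 0"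
  shows "v \<in> gen_eigenspace 0"
proof -
  obtain B w where B: "independent B" "span B = UNIV"
    and w: "\<And>b. b \<in> B \<Longrightarrow> b \<in> gen_eigenspace (w b)"
    and tri: "\<And>b. b \<in> B \<Longrightarrow> T b - w b *s b \<in> span (B - {b})"
    by (rule triangular_eigenbasis) blast
  have "finite B" using B(1) by (rule finiteI_independent)
  have diag: "representation B (T b) b = w b" if b: "b \<in> B" for b
  proof -
    have "representation B (T b - w b *s b) b = representation (B - {b}) (T b - w b *s b) b"
      using representation_extend[OF B(1) tri[OF b]] by auto
    also have "\<dots> = 0" using representation_ne_zero by blast
    finally show ?thesis
      using B b by (simp add: representation_diff representation_scale representation_basis)
  qed
  have "w b = 0" if b: "b \<in> B" for b
  proof (rule ccontr)
    assume "w b \<noteq> 0"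
    then obtain q :: "'k \<Rightarrow> rat" where q: "q (w b) \<noteq> 0" "\<And>x y. q (x + y) = q x + q y"
      "\<And>r x. q (of_rat r * x) = r * q x"
      by (rule rational_functional_exists) blast
    obtain D where D: "linear_endo D" "\<And>a v. v \<in> gen_eigenspace a \<Longrightarrow> D v = of_rat (q a) *s v"
      by (rule weight_map_exists[of "\<lambda>a. of_rat (q a)"]) blast
    have "linear_endo (\<lambda>v. T (D v))"
      by (rule linear_endoI) (simp_all add: T_add T_scale linear_endoD[OF D(1)])
    then have "tr (\<lambda>v. T (D v)) = (\<Sum>b\<in>B. representation B (T (D b)) b)"
      using tr_basis[OF B] by (simp add: basis_trace_def)
    also have "\<dots> = (\<Sum>b\<in>B. of_rat (q (w b)) * w b)"
      using B by (intro sum.cong) (simp_all add: D(2)[OF w] T_scale representation_scale diag)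
    finally have zero: "(\<Sum>b\<in>B. of_rat (q (w b)) * w b) = 0"
      using vanish[OF D(1) q(2) D(2)] by simp
    have q0: "q 0 = 0" using q(2)[of 0 0] by simp
    have q_sum: "q (sum h S) = (\<Sum>x\<in>S. q (h x))" for h :: "'v \<Rightarrow> 'k" and S
      by (induction S rule: infinite_finite_induct) (simp_all add: q0 q(2))
    have "(\<Sum>b\<in>B. q (w b) * q (w b)) = q (\<Sum>b\<in>B. of_rat (q (w b)) * w b)"
      by (simp add: q_sum q(3))
    then have "(\<Sum>b\<in>B. q (w b) * q (w b)) = 0" using zero q0 by simp
    then have "q (w b) * q (w b) = 0"
      using sum_nonneg_eq_0_iff[OF \<open>finite B\<close>, of "\<lambda>b. q (w b) * q (w b)"] b by simp
    with q(1) show False by simp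
  qed
  then have "B \<subseteq> gen_eigenspace 0" using w by fastforce
  then have "span B \<subseteq> gen_eigenspace 0"
    using subspace_gen_eigenspace by (rule span_minimal)
  with B(2) show ?thesis by blast
qed

end

lemma (in alg_closed_endomorphism) gen_eigenspaces_induct:
  assumes "subspace {v. P v}" "\<And>a v. v \<in> gen_eigenspace a \<Longrightarrow> P v"
  shows "P v"
proof -
  have "span (\<Union>a. UNIV \<inter> gen_eigenspace a) \<subseteq> {v. P v}"
    using assms by (intro span_minimal) auto
  moreover have "span (\<Union>a. UNIV \<inter> gen_eigenspace a) = UNIV"
    by (rule stable_span_gen_eigenspaces) (simp add: stable_def)
  ultimately show ?thesis by auto
qed

section \<open>Finite-dimensional Lie algebras and the Killing form\<close>

locale fd_lie_algebra = finite_dimensional_vector_space scale Basis + lie_algebra scale UNIV br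
  for scale :: "'k::{alg_closed_field, field_char_0} \<Rightarrow> 'g::ab_group_add \<Rightarrow> 'g" (infixr \<open>*s\<close> 75)
    and Basis :: "'g set" and br :: "'g \<Rightarrow> 'g \<Rightarrow> 'g"
begin

lemma br_add_left: "br (x + y) z = br x z + br y z"
  and br_scale_left: "br (c *s x) z = c *s br x z"
  and br_add_right: "br z (x + y) = br z x + br z y"
  and br_scale_right: "br z (c *s x) = c *s br z x"
  using bilinear by (auto simp: bilinear_on_def linear_on_def)

lemma br_0_left [simp]: "br 0 x = 0"
  using br_scale_left[of 0 0 x] by simp

lemma br_0_right [simp]: "br x 0 = 0"
  using br_scale_right[of x 0 0] by simp

lemma br_self [simp]: "br x x = 0"
  using alternating by simp

lemma br_minus_left: "br (- x) y = - br x y"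
  using br_add_left[of x "- x" y] by (simp add: minus_unique)

lemma br_minus_right: "br x (- y) = - br x y"
  using br_add_right[of x y "- y"] by (simp add: minus_unique)

lemma br_diff_left: "br (x - y) z = br x z - br y z"
  using br_add_left[of x "- y" z] by (simp add: br_minus_left)

lemma br_diff_right: "br z (x - y) = br z x - br z y"
  using br_add_right[of z x "- y"] by (simp add: br_minus_right)

lemma br_antisym: "br y x = - br x y"
proof -
  have "br y x + br x y = 0"
    using br_self[of "x + y"] unfolding br_add_left br_add_right by (simp add: add.commute)
  then show ?thesis by (simp add: eq_neg_iff_add_eq_0)
qed

text \<open>
  The Jacobi identity, read as saying that \<open>br x\<close> is a derivation.
\<close>

lemma br_derivation: "br x (br y z) = br (br x y) z + br y (br x z)"
proof -
  have "br (br x y) z + br (br y z) x + br (br z x) y = 0" by (rule jacobi) simp_all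
  moreover have "br (br y z) x = - br x (br y z)" by (rule br_antisym)
  moreover have "br (br z x) y = br y (br x z)"
    by (subst br_antisym, subst br_antisym[of z x]) (simp add: br_minus_right)
  ultimately show ?thesis by (simp add: algebra_simps)
qed

lemma linear_br: "linear_endo (br x)"
  by (rule linear_endoI) (simp_all add: br_add_right br_scale_right)

sublocale ad: char_0_endomorphism scale Basis "br x" for x
  by unfold_locales (simp_all add: br_add_right br_scale_right)

text \<open>
  Because \<open>br x\<close> is a derivation, \<open>br x - (a + b)\<close> sends \<open>br u v\<close> to
  \<open>br (br x u - a u) v + br u (br x v - b v)\<close>, and in each term one argument is closer to zero.
\<close>

lemma br_gen_eigenspaces:
  assumes "u \<in> ad.gen_eigenspace x a" "v \<in> ad.gen_eigenspace x b"
  shows "br u v \<in> ad.gen_eigenspace x (a + b)"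
  using assms
proof (induction arbitrary: v)
  case zero
  then show ?case by (simp add: ad.gen_eigenspace.zero)
next
  case (step u)
  note outer = step.IH
  from step.prems show ?case
  proof induction
    case zero
    then show ?case by (simp add: ad.gen_eigenspace.zero)
  next
    case (step v)
    have "br (br x u - a *s u) v + br u (br x v - b *s v) \<in> ad.gen_eigenspace x (a + b)"
      using outer[OF ad.gen_eigenspace.step[OF step.hyps]] step.IH
      by (rule subspace_add[OF ad.subspace_gen_eigenspace])
    also have "br (br x u - a *s u) v + br u (br x v - b *s v) = br x (br u v) - (a + b) *s br u v"
      by (simp add: br_derivation[of x u v] br_diff_left br_diff_right br_scale_left br_scale_right
          scale_left_distrib algebra_simps)
    finally show ?case by (rule ad.gen_eigenspace.step)
  qed
qed

abbreviation kf :: "'g \<Rightarrow> 'g \<Rightarrow> 'k" where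
  "kf \<equiv> killing_form scale Basis br"

lemma linear_br_br: "linear_endo (\<lambda>z. br x (br y z))"
  by (rule linear_endoI) (simp_all add: br_add_right br_scale_right)

lemma kf_commute: "kf x y = kf y x"
  unfolding killing_form_def by (rule tr_compose_commute[OF linear_br linear_br])

lemma kf_add_left: "kf (x + y) z = kf x z + kf y z"
  unfolding killing_form_def by (simp add: br_add_left tr_add)

lemma kf_scale_left: "kf (c *s x) z = c * kf x z"
  unfolding killing_form_def by (simp add: br_scale_left tr_scale)

lemma kf_diff_left: "kf (x - y) z = kf x z - kf y z"
  unfolding killing_form_def by (simp add: br_diff_left tr_diff)

lemma kf_0_left [simp]: "kf 0 z = 0"
  using kf_scale_left[of 0 0 z] by simp

lemma kf_add_right: "kf z (x + y) = kf z x + kf z y"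
  using kf_add_left kf_commute by metis

lemma kf_scale_right: "kf z (c *s x) = c * kf z x"
  using kf_scale_left kf_commute by metis

lemma kf_invariant: "kf (br x y) z = kf x (br y z)"
proof -
  have "kf (br x y) z = tr (\<lambda>v. br x (br y (br z v)) - br y (br x (br z v)))"
    unfolding killing_form_def by (simp add: br_derivation[of x y])
  also have "\<dots> = tr (\<lambda>v. br x (br y (br z v))) - tr (\<lambda>v. br y (br x (br z v)))"
    by (rule tr_diff)
  also have "tr (\<lambda>v. br y (br x (br z v))) = tr (\<lambda>v. br x (br z (br y v)))"
    by (rule tr_compose_commute[OF linear_br linear_br_br])
  also have "tr (\<lambda>v. br x (br y (br z v))) - tr (\<lambda>v. br x (br z (br y v)))
      = tr (\<lambda>v. br x (br y (br z v)) - br x (br z (br y v)))"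
    by (rule tr_diff[symmetric])
  also have "\<dots> = kf x (br y z)"
    unfolding killing_form_def by (simp add: br_derivation[of y z] br_add_right)
  finally show ?thesis .
qed

text \<open>
  Take coordinates \<open>kf x c\<close> along a basis of \<open>S\<close> to define a linear map \<open>F\<close> into \<open>S\<close> whose kernel is
  the orthogonal complement of \<open>S\<close>. Nondegeneracy makes \<open>F\<close> injective on \<open>S\<close>, so it maps \<open>S\<close> onto
  \<open>S\<close>, and an element of \<open>S\<close> with the same image as \<open>x\<close> is the projection of \<open>x\<close>.
\<close>

lemma orthogonal_projection_exists:
  assumes S: "subspace S" and nondeg: "\<And>s. s \<in> S \<Longrightarrow> (\<And>t. t \<in> S \<Longrightarrow> kf s t = 0) \<Longrightarrow> s = 0"
  shows "\<exists>s\<in>S. \<forall>t\<in>S. kf (x - s) t = 0"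
proof -
  obtain C where C: "finite C" "C \<subseteq> S" "independent C" "span C = S"
    using basis_subspace_exists[OF S] by metis
  define F where "F x = (\<Sum>c\<in>C. kf x c *s c)" for x
  have F: "linear_endo F"
    by (rule linear_endoI)
      (simp_all add: F_def kf_add_left kf_scale_left scale_left_distrib sum.distrib scale_sum_right)
  have FS: "F x \<in> S" for x
    unfolding F_def using C(2) S by (blast intro: subspace_sum subspace_scale)
  have F0: "kf x t = 0" if "F x = 0" "t \<in> S" for x t
  proof -
    have "kf x c = 0" if "c \<in> C" for c
      using independentD[OF C(3,1) subset_refl] \<open>F x = 0\<close> that unfolding F_def by blast
    then have "C \<subseteq> {t. kf x t = 0}" by blast
    moreover have "subspace {t. kf x t = 0}"
      by (rule subspaceI) (simp_all add: kf_add_right kf_scale_right kf_commute[of x 0])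
    ultimately have "S \<subseteq> {t. kf x t = 0}" using C(4) span_minimal by blast
    with that show ?thesis by blast
  qed
  have "inj_on F S"
  proof (rule inj_onI)
    fix x y assume xy: "x \<in> S" "y \<in> S" "F x = F y"
    have "F (x - y) = 0" using xy module_hom.diff[OF module_hom_linearI[OF F]] by simp
    then have "x - y = 0" using nondeg[OF subspace_diff[OF S xy(1,2)]] F0 by blast
    then show "x = y" by simp
  qed
  interpret finite_dimensional_vector_space_pair_1 scale Basis scale ..
  have "span S = S" using S by simp
  then have "dim (F ` S) = dim S"
    by (intro dim_image_eq F) (simp only: \<open>inj_on F S\<close>)
  moreover have "subspace (F ` S)"
    using module_hom.subspace_image[OF module_hom_linearI[OF F] S] .
  ultimately have "F ` S = S"
    using FS S by (intro subspace_dim_equal) auto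
  then obtain s where s: "s \<in> S" "F s = F x" using FS[of x] by (metis imageE)
  then have "F (x - s) = 0" using module_hom.diff[OF module_hom_linearI[OF F]] by simp
  with s F0 show ?thesis by blast
qed

section \<open>Engel's theorem\<close>

definition ad_nilpotent :: "'g \<Rightarrow> bool" where
  "ad_nilpotent x \<longleftrightarrow> (\<forall>v. v \<in> ad.gen_eigenspace x 0)"

text \<open>
  The conclusion of Engel's theorem for the action of \<open>K\<close> on the quotients \<open>W / U\<close> of invariant
  subspaces of the ambient Lie algebra, phrased so that no quotient spaces appear.
\<close>

definition has_common_null_vectors :: "'g set \<Rightarrow> bool" where
  "has_common_null_vectors K \<longleftrightarrow> (\<forall>U W. subspace U \<and> subspace W \<and> U \<subset> W \<and>
     (\<forall>x\<in>K. \<forall>u\<in>U. br x u \<in> U) \<and> (\<forall>x\<in>K. \<forall>w\<in>W. br x w \<in> W) \<longrightarrow>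
     (\<exists>w\<in>W - U. \<forall>x\<in>K. br x w \<in> U))"

lemma common_null_vector:
  assumes "has_common_null_vectors K" "subspace U" "subspace W" "U \<subset> W"
    "\<And>x u. x \<in> K \<Longrightarrow> u \<in> U \<Longrightarrow> br x u \<in> U" "\<And>x w. x \<in> K \<Longrightarrow> w \<in> W \<Longrightarrow> br x w \<in> W"
  obtains w where "w \<in> W" "w \<notin> U" "\<And>x. x \<in> K \<Longrightarrow> br x w \<in> U"
proof -
  have "\<exists>w\<in>W - U. \<forall>x\<in>K. br x w \<in> U"
    using assms(1)[unfolded has_common_null_vectors_def, rule_format, of U W] assms(2-) by blast
  then show thesis using that by blast
qed

text \<open>
  Let \<open>K'\<close> be a largest subalgebra of \<open>K\<close> with the property. If \<open>K' \<noteq> K\<close>, the property for \<open>K / K'\<close>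
  gives \<open>z\<close> outside \<open>K'\<close> that normalises \<open>K'\<close>. Then \<open>z\<close> acts nilpotently on the vectors of \<open>W / U\<close>
  killed by \<open>K'\<close> and so kills one of them, which shows that the larger subalgebra spanned by \<open>K'\<close> and
  \<open>z\<close> has the property.
\<close>

lemma engel:
  assumes K: "lie_subalgebra scale UNIV br K" and nil: "\<And>x. x \<in> K \<Longrightarrow> ad_nilpotent x"
  shows "has_common_null_vectors K"
proof -
  let ?good = "\<lambda>K'. lie_subalgebra scale UNIV br K' \<and> K' \<subseteq> K \<and> has_common_null_vectors K'"
  have "?good {0}"
    using K unfolding lie_subalgebra_def has_common_null_vectors_def
    by (auto simp: subspace_0)
  moreover have "\<forall>K'. ?good K' \<longrightarrow> dim K' < Suc (dim UNIV)"
    using dim_subset[OF subset_UNIV] by (simp add: less_Suc_eq_le)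
  ultimately obtain K' where K': "?good K'" and max: "\<And>L. ?good L \<Longrightarrow> dim L \<le> dim K'"
    using ex_has_greatest_nat[of ?good "{0}" dim "Suc (dim UNIV)"] by blast
  have subK: "subspace K" "\<And>x y. x \<in> K \<Longrightarrow> y \<in> K \<Longrightarrow> br x y \<in> K"
    using K unfolding lie_subalgebra_def by auto
  have subK': "subspace K'" "\<And>x y. x \<in> K' \<Longrightarrow> y \<in> K' \<Longrightarrow> br x y \<in> K'" "K' \<subseteq> K"
    using K' unfolding lie_subalgebra_def by auto
  have "K' = K"
  proof (rule ccontr)
    assume "K' \<noteq> K"
    then have "K' \<subset> K" using subK' by blast
    then obtain z where z: "z \<in> K" "z \<notin> K'" "\<And>x. x \<in> K' \<Longrightarrow> br x z \<in> K'"
      using common_null_vector[of K' K' K] K' subK' subK by blast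
    define L where "L = {k + c *s z | k c. k \<in> K'}"
    have "subspace L"
    proof -
      have "L = {x + y | x y. x \<in> K' \<and> y \<in> span {z}}"
        unfolding L_def span_singleton by auto
      then show ?thesis using subspace_sums[OF subK'(1) subspace_span] by simp
    qed
    have "K' \<subseteq> L" unfolding L_def by (force intro: exI[of _ 0])
    have "z \<in> L" unfolding L_def using subspace_0[OF subK'(1)] by (force intro: exI[of _ 1])
    have "L \<subseteq> K" unfolding L_def using subK' subK z by (auto intro: subspace_add subspace_scale)
    have "br x y \<in> L" if "x \<in> L" "y \<in> L" for x y
    proof -
      from that obtain k c l d where xy: "x = k + c *s z" "y = l + d *s z" "k \<in> K'" "l \<in> K'"
        unfolding L_def by blast
      have "br x y = br k l + d *s br k z - c *s br l z"
        unfolding xy by (simp add: br_add_left br_add_right br_scale_left br_scale_right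
            br_antisym[of l z] algebra_simps)
      also have "\<dots> \<in> K'"
        using xy(3,4) subK' z(3) by (intro subspace_diff subspace_add subspace_scale) auto
      finally show ?thesis using \<open>K' \<subseteq> L\<close> by blast
    qed
    then have "lie_subalgebra scale UNIV br L"
      using \<open>subspace L\<close> unfolding lie_subalgebra_def by simp
    moreover have "has_common_null_vectors L"
      unfolding has_common_null_vectors_def
    proof (intro allI impI, elim conjE)
      fix U W
      assume U: "subspace U" and W: "subspace W" and "U \<subset> W"
        and LU: "\<forall>x\<in>L. \<forall>u\<in>U. br x u \<in> U" and LW: "\<forall>x\<in>L. \<forall>w\<in>W. br x w \<in> W"
      let ?W0 = "{w \<in> W. \<forall>x\<in>K'. br x w \<in> U}"
      obtain w where "w \<in> ?W0" "w \<notin> U"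
      proof (rule common_null_vector[of K' U W])
        show "br x u \<in> U" if "x \<in> K'" "u \<in> U" for x u using LU \<open>K' \<subseteq> L\<close> that by blast
        show "br x w \<in> W" if "x \<in> K'" "w \<in> W" for x w using LW \<open>K' \<subseteq> L\<close> that by blast
      qed (use K' U W \<open>U \<subset> W\<close> in auto)
      have z_W0: "br z w \<in> ?W0" if "w \<in> ?W0" for w
      proof -
        have "br x (br z w) \<in> U" if "x \<in> K'" for x
        proof -
          have "br (br x z) w \<in> U" "br z (br x w) \<in> U"
            using \<open>w \<in> ?W0\<close> z(3)[OF that] that LU \<open>z \<in> L\<close> by auto
          then show ?thesis
            unfolding br_derivation[of x z] by (rule subspace_add[OF U])
        qed
        then show ?thesis using that LW \<open>z \<in> L\<close> by auto
      qed
      have "w \<in> ad.gen_eigenspace z 0"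
        using nil z(1) unfolding ad_nilpotent_def by blast
      then have "\<exists>v\<in>?W0. v \<notin> U \<and> br z v \<in> U"
        using \<open>w \<in> ?W0\<close> \<open>w \<notin> U\<close>
      proof induction
        case zero
        then show ?case using subspace_0[OF U] by blast
      next
        case (step w)
        then show ?case using z_W0[OF step.prems(1)] by (cases "br z w \<in> U") auto
      qed
      then obtain v where v: "v \<in> ?W0" "v \<notin> U" "br z v \<in> U" by blast
      have "br x v \<in> U" if "x \<in> L" for x
      proof -
        from that obtain k c where "x = k + c *s z" "k \<in> K'" unfolding L_def by blast
        then show ?thesis
          using v U by (simp add: br_add_left br_scale_left subspace_add subspace_scale)
      qed
      then show "\<exists>w\<in>W - U. \<forall>x\<in>L. br x w \<in> U" using v by blast
    qed
    ultimately have "dim L \<le> dim K'" using max \<open>L \<subseteq> K\<close> by blast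
    moreover have "K' \<subset> L" using \<open>K' \<subseteq> L\<close> \<open>z \<in> L\<close> z(2) by blast
    then have "dim K' < dim L"
      using dim_psubset[of K' L] \<open>subspace L\<close> subK'(1) span_eq_iff by metis
    ultimately show False by simp
  qed
  then show ?thesis using K' by blast
qed

section \<open>Ideals on which the Killing form vanishes\<close>

text \<open>
  The heart of Cartan's criterion. The map \<open>D\<close> given by an additive function \<open>q\<close> of the eigenvalues of
  \<open>br x\<close> is a derivation preserving \<open>R\<close>, hence \<open>[br b, D] = - br (D b)\<close>, and by the cyclic property
  the trace of \<open>br (br a b) D\<close> is \<open>- kf a (D b)\<close>.
\<close>

lemma isotropic_derived_algebra_nilpotent:
  assumes R: "subspace R" and sub: "\<And>a b. a \<in> R \<Longrightarrow> b \<in> R \<Longrightarrow> br a b \<in> R"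
    and iso: "\<And>a b. a \<in> R \<Longrightarrow> b \<in> R \<Longrightarrow> kf a b = 0"
    and x: "x \<in> span {br a b | a b. a \<in> R \<and> b \<in> R}"
  shows "ad_nilpotent x"
proof -
  have "v \<in> ad.gen_eigenspace x 0" for v
  proof (rule ad.nilpotent_if_weight_traces_vanish)
    fix D and q :: "'k \<Rightarrow> rat"
    assume D: "linear_endo D" and q: "\<And>a b. q (a + b) = q a + q b"
      and Dq: "\<And>a v. v \<in> ad.gen_eigenspace x a \<Longrightarrow> D v = of_rat (q a) *s v"
    note D_lin = linear_endoD[OF D]
    have derivation: "D (br u v) = br (D u) v + br u (D v)" for u v
    proof (rule ad.gen_eigenspaces_induct[where P = "\<lambda>u. D (br u v) = br (D u) v + br u (D v)"])
      show "subspace {u. D (br u v) = br (D u) v + br u (D v)}"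
        using D_lin[of 0] D_lin(2)[of 0 0]
        by (intro subspaceI)
          (auto simp: D_lin br_add_left br_scale_left scale_right_distrib algebra_simps)
      fix a u assume u: "u \<in> ad.gen_eigenspace x a"
      show "D (br u v) = br (D u) v + br u (D v)"
      proof (rule ad.gen_eigenspaces_induct[where P = "\<lambda>v. D (br u v) = br (D u) v + br u (D v)"])
        show "subspace {v. D (br u v) = br (D u) v + br u (D v)}"
          using D_lin(2)[of 0 0]
          by (intro subspaceI)
            (auto simp: D_lin br_add_right br_scale_right scale_right_distrib algebra_simps)
        fix b v assume v: "v \<in> ad.gen_eigenspace x b"
        show "D (br u v) = br (D u) v + br u (D v)"
          using Dq[OF u] Dq[OF v] Dq[OF br_gen_eigenspaces[OF u v]]
          by (simp add: q of_rat_add br_scale_left br_scale_right scale_left_distrib)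
      qed
    qed
    have "x \<in> R" using x sub R span_minimal[of "{br a b | a b. a \<in> R \<and> b \<in> R}" R] by blast
    have DR: "D r \<in> R" if "r \<in> R" for r
    proof -
      have "ad.stable x R" using R sub \<open>x \<in> R\<close> by (simp add: ad.stable_def)
      then have "r \<in> span (\<Union>a. R \<inter> ad.gen_eigenspace x a)"
        using ad.stable_span_gen_eigenspaces that by blast
      moreover have "span (\<Union>a. R \<inter> ad.gen_eigenspace x a) \<subseteq> {r. D r \<in> R}"
      proof (rule span_minimal)
        show "subspace {r. D r \<in> R}"
          using R D_lin(2)[of 0 0]
          by (intro subspaceI) (auto simp: D_lin subspace_0 subspace_add subspace_scale)
      qed (auto simp: Dq subspace_scale[OF R])
      ultimately show ?thesis by blast
    qed
    have "tr (\<lambda>v. br y (D v)) = 0" if "y \<in> span {br a b | a b. a \<in> R \<and> b \<in> R}" for y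
      using that
    proof (induction rule: span_induct)
      case base
      show ?case
        by (intro subspaceI)
          (simp_all add: br_add_left br_scale_left tr_add tr_scale)
    next
      case (step y)
      then obtain a b where y: "y = br a b" "a \<in> R" "b \<in> R" by blast
      \<comment> \<open>the cyclic property moves \<open>br b\<close> behind \<open>D\<close>, which makes a commutator of \<open>br b\<close> and \<open>D\<close>\<close>
      have "tr (\<lambda>v. br b (br a (D v))) = tr (\<lambda>v. br a (D (br b v)))"
        by (rule tr_compose_commute[OF linear_br linear_endoI])
          (simp_all add: D_lin br_add_right br_scale_right)
      moreover have "tr (\<lambda>v. br y (D v)) = tr (\<lambda>v. br a (br b (D v)) - br b (br a (D v)))"
        unfolding y by (simp add: br_derivation[of a b])
      ultimately have "tr (\<lambda>v. br y (D v)) = tr (\<lambda>v. br a (br b (D v)) - br a (D (br b v)))"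
        by (simp only: tr_diff)
      also have "\<dots> = tr (\<lambda>v. (- 1) *s br a (br (D b) v))"
        by (simp add: derivation br_add_right)
      also have "\<dots> = - kf a (D b)"
        unfolding tr_scale killing_form_def by simp
      also have "\<dots> = 0" using iso y(2,3) DR by simp
      finally show ?case .
    qed
    then show "tr (\<lambda>v. br x (D v)) = 0" using x by blast
  qed
  then show ?thesis unfolding ad_nilpotent_def by blast
qed

text \<open>
  The absence of abelian ideals is what semisimplicity contributes.
  Engel's theorem yields a nonzero centre of the derived algebra \<open>N\<close> of \<open>R\<close> unless \<open>N = 0\<close>; this
  centre is an ideal of \<open>H\<close>, since \<open>N\<close> is one.
\<close>

lemma isotropic_ideal_zero:
  assumes no_abelian: "\<And>A. \<lbrakk>subspace A; A \<subseteq> H; \<And>x a. x \<in> H \<Longrightarrow> a \<in> A \<Longrightarrow> br x a \<in> A;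
      \<And>a b. a \<in> A \<Longrightarrow> b \<in> A \<Longrightarrow> br a b = 0\<rbrakk> \<Longrightarrow> A = {0}"
    and R: "subspace R" "R \<subseteq> H" and ideal: "\<And>x r. x \<in> H \<Longrightarrow> r \<in> R \<Longrightarrow> br x r \<in> R"
    and iso: "\<And>a b. a \<in> R \<Longrightarrow> b \<in> R \<Longrightarrow> kf a b = 0"
  shows "R = {0}"
proof -
  let ?N = "span {br a b | a b. a \<in> R \<and> b \<in> R}"
  have N_R: "?N \<subseteq> R" using R ideal by (intro span_minimal) auto
  have N_ideal: "br x n \<in> ?N" if "x \<in> H" "n \<in> ?N" for x n
    using that(2)
  proof (induction rule: span_induct)
    case base
    show ?case
      by (intro subspaceI)
        (auto simp: br_add_right br_scale_right span_zero intro: span_add span_scale)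
  next
    case (step n)
    then obtain a b where n: "n = br a b" "a \<in> R" "b \<in> R" by blast
    have "br (br x a) b \<in> ?N" "br a (br x b) \<in> ?N"
      using n ideal[OF that(1)] by (auto intro!: span_base)
    then show ?case unfolding n br_derivation[of x a b] by (auto intro: span_add)
  qed
  have N_sub: "lie_subalgebra scale UNIV br ?N"
    using N_ideal N_R R unfolding lie_subalgebra_def by blast
  have nil: "ad_nilpotent x" if "x \<in> ?N" for x
    using that R ideal iso by (intro isotropic_derived_algebra_nilpotent[of R]) auto
  have "?N = {0}"
  proof (rule ccontr)
    assume "?N \<noteq> {0}"
    let ?Z = "{z \<in> ?N. \<forall>x\<in>?N. br x z = 0}"
    have "{0} \<subset> ?N" using \<open>?N \<noteq> {0}\<close> span_zero by blast
    have "has_common_null_vectors ?N" using N_sub nil by (rule engel)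
    then obtain z where z: "z \<in> ?N" "z \<notin> {0}" "\<And>x. x \<in> ?N \<Longrightarrow> br x z \<in> {0}"
    proof (rule common_null_vector[OF _ subspace_single_0 subspace_span \<open>{0} \<subset> ?N\<close>])
      show "br x u \<in> {0}" if "u \<in> {0}" for x u using that by simp
      show "br x w \<in> ?N" if "x \<in> ?N" "w \<in> ?N" for x w
        using N_sub that unfolding lie_subalgebra_def by blast
    qed blast
    have "?Z = {0}"
    proof (rule no_abelian)
      show "subspace ?Z"
        by (intro subspaceI)
          (auto simp: br_add_right br_scale_right span_zero intro: span_add span_scale)
      show "?Z \<subseteq> H" using N_R R by blast
      show "br a b = 0" if "a \<in> ?Z" "b \<in> ?Z" for a b using that by blast
      fix x z assume x: "x \<in> H" and z: "z \<in> ?Z"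
      have "br y (br x z) = 0" if "y \<in> ?N" for y
      proof -
        have "br y x \<in> ?N"
          unfolding br_antisym[of y x] using N_ideal[OF x that] by (rule span_neg)
        then show ?thesis using z that unfolding br_derivation[of y x z] by simp
      qed
      then show "br x z \<in> ?Z" using N_ideal[OF x] z by blast
    qed
    with z show False by blast
  qed
  then have "br a b = 0" if "a \<in> R" "b \<in> R" for a b
    using that span_base[of "br a b" "{br a b | a b. a \<in> R \<and> b \<in> R}"] by blast
  then show ?thesis using R ideal by (intro no_abelian) auto
qed

end

section \<open>Transport of the Lie algebra axioms\<close>

lemma lie_algebra_transport:
  assumes L: "lie_algebra s L br" and V': "vector_space s'" and L': "module.subspace s' L'"
    and f: "linear_on s L s' L' f" "bij_betw f L L'"
    and hom: "\<And>x y. x \<in> L \<Longrightarrow> y \<in> L \<Longrightarrow> f (br x y) = br' (f x) (f y)"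
  shows "lie_algebra s' L' br'"
proof -
  interpret lie_algebra s L br by fact
  interpret V': vector_space s' by fact
  have im: "L' = f ` L" using f(2) by (simp add: bij_betw_def)
  have f_add: "f (x + y) = f x + f y" if "x \<in> L" "y \<in> L" for x y
    using f(1) that by (auto simp: linear_on_def)
  have f_scale: "f (s c x) = s' c (f x)" if "x \<in> L" for c x
    using f(1) that by (auto simp: linear_on_def)
  have br_L: "br x y \<in> L" if "x \<in> L" "y \<in> L" for x y
    using bilinear that by (auto simp: bilinear_on_def linear_on_def)
  have br_add: "br x (y + z) = br x y + br x z" "br (y + z) x = br y x + br z x"
    if "x \<in> L" "y \<in> L" "z \<in> L" for x y z
    using bilinear that by (auto simp: bilinear_on_def linear_on_def)
  have br_scale: "br x (s c y) = s c (br x y)" "br (s c y) x = s c (br y x)"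
    if "x \<in> L" "y \<in> L" for x y c
    using bilinear that by (auto simp: bilinear_on_def linear_on_def)
  have add_L: "x + y \<in> L" if "x \<in> L" "y \<in> L" for x y
    using subspace_add[OF subspace_carrier that] .
  have scale_L: "s c x \<in> L" if "x \<in> L" for c x
    using subspace_scale[OF subspace_carrier that] .
  have f_0: "f 0 = 0"
    using f_scale[of 0 0] subspace_0[OF subspace_carrier] by simp
  show ?thesis
  proof
    show "V'.subspace L'" by fact
    have "bilinear_on s' (f ` L) s' (f ` L) br'"
      unfolding bilinear_on_def linear_on_def
      by (simp add: br_L br_add br_scale add_L scale_L f_add[symmetric] f_scale[symmetric] hom[symmetric])
    then show "bilinear_on s' L' s' L' br'" by (simp only: im)
    show "br' x x = 0" if "x \<in> L'" for x
    proof -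
      obtain u where "u \<in> L" "x = f u" using \<open>x \<in> L'\<close> im by blast
      then show ?thesis using hom[of u u] by (simp add: alternating f_0)
    qed
    show "br' (br' x y) z + br' (br' y z) x + br' (br' z x) y = 0"
      if xyz: "x \<in> L'" "y \<in> L'" "z \<in> L'" for x y z
    proof -
      obtain u v w where uvw: "u \<in> L" "v \<in> L" "w \<in> L" and x: "x = f u" "y = f v" "z = f w"
        using xyz im by blast
      have "f (br (br u v) w + br (br v w) u + br (br w u) v)
          = br' (br' x y) z + br' (br' y z) x + br' (br' z x) y"
        using uvw unfolding x by (simp add: f_add hom br_L add_L)
      then show ?thesis using jacobi[OF uvw] f_0 by simp
    qed
  qed
qed

lemma lie_isomorphicI:
  assumes L: "lie_algebra s L br" and V': "vector_space s'" and L': "module.subspace s' L'"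
    and f: "linear_on s L s' L' f" "bij_betw f L L'"
    and hom: "\<And>x y. x \<in> L \<Longrightarrow> y \<in> L \<Longrightarrow> f (br x y) = br' (f x) (f y)"
  shows "lie_isomorphic s L br s' L' br'"
proof -
  have "lie_algebra s' L' br'"
    using lie_algebra_transport[where br = br and br' = br', OF L V' L' f hom] .
  moreover have "\<forall>x\<in>L. \<forall>y\<in>L. f (br x y) = br' (f x) (f y)"
    by (intro ballI hom)
  ultimately show ?thesis
    unfolding lie_isomorphic_def by (intro conjI exI[of _ f] L f)
qed

lemma (in lie_algebra) lie_algebra_subalgebra:
  assumes "lie_subalgebra s L br K"
  shows "lie_algebra s K br"
proof
  have K: "K \<subseteq> L" "subspace K" "\<And>x y. x \<in> K \<Longrightarrow> y \<in> K \<Longrightarrow> br x y \<in> K"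
    using assms by (auto simp: lie_subalgebra_def)
  then show "subspace K" by blast
  show "bilinear_on s K s K br"
    using bilinear K unfolding bilinear_on_def linear_on_def by (auto simp: subset_iff)
  show "br x x = 0" if "x \<in> K" for x using that K alternating by blast
  show "br (br x y) z + br (br y z) x + br (br z x) y = 0" if "x \<in> K" "y \<in> K" "z \<in> K" for x y z
    using that K jacobi by blast
qed

lemma vector_space_fun_scale:
  assumes "vector_space s" shows "vector_space (fun_scale s)"
proof -
  interpret vector_space s by fact
  show ?thesis
    by unfold_locales (auto simp: fun_scale_def fun_eq_iff scale_right_distrib scale_left_distrib)
qed

lemma vector_space_enveloping_scale:
  assumes "vector_space s" shows "vector_space (enveloping_scale s)"
proof -
  interpret vector_space s by fact
  interpret F: vector_space "fun_scale s" using assms by (rule vector_space_fun_scale)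
  show ?thesis
    by unfold_locales
      (auto simp: enveloping_scale_def scale_right_distrib scale_left_distrib
        F.scale_right_distrib F.scale_left_distrib)
qed

section \<open>Reductive decompositions\<close>

lemma proj_along_eq:
  assumes "internal_direct_sum s V U W" "vector_space s" "u \<in> U" "w \<in> W"
  shows "proj_along U W (u + w) = u"
  unfolding proj_along_def
proof (rule the_equality)
  interpret vector_space s by fact
  have UW: "subspace U" "subspace W" "U \<inter> W = {0}"
    using assms(1) by (auto simp: internal_direct_sum_def)
  show "u \<in> U \<and> (\<exists>w'\<in>W. u + w = u + w')" using assms by blast
  fix u' assume "u' \<in> U \<and> (\<exists>w'\<in>W. u + w = u' + w')"
  then obtain w' where u': "u' \<in> U" "w' \<in> W" "u + w = u' + w'" by blast
  have "u' - u = w - w'" using u'(3) by (simp add: algebra_simps)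
  then have "u' - u \<in> U \<inter> W"
    using u' assms(3,4) subspace_diff[OF UW(1)] subspace_diff[OF UW(2)] by (metis IntI)
  then show "u' = u" using UW(3) by simp
qed

lemma internal_direct_sum_swap:
  "internal_direct_sum s V U W \<Longrightarrow> internal_direct_sum s V W U"
  unfolding internal_direct_sum_def by (auto simp: add.commute Int_commute) (metis add.commute)+

locale reductive_lie_algebra = fd_lie_algebra scale Basis br
  for scale :: "'k::{alg_closed_field, field_char_0} \<Rightarrow> 'g::ab_group_add \<Rightarrow> 'g" (infixr \<open>*s\<close> 75)
    and Basis :: "'g set" and br :: "'g \<Rightarrow> 'g \<Rightarrow> 'g" +
  fixes H M :: "'g set"
  assumes decomposition: "reductive_decomposition scale UNIV br H M"
begin

abbreviation pH :: "'g \<Rightarrow> 'g" where "pH \<equiv> proj_along H M"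
abbreviation pM :: "'g \<Rightarrow> 'g" where "pM \<equiv> proj_along M H"

lemma direct_sum: "internal_direct_sum scale UNIV H M"
  and subalgebra_H: "lie_subalgebra scale UNIV br H"
  and br_HM: "a \<in> H \<Longrightarrow> m \<in> M \<Longrightarrow> br a m \<in> M"
  using decomposition by (auto simp: reductive_decomposition_def)

lemma subspace_H: "subspace H" and subspace_M: "subspace M" and disjoint: "H \<inter> M = {0}"
  using direct_sum by (auto simp: internal_direct_sum_def)

lemma br_HH: "a \<in> H \<Longrightarrow> b \<in> H \<Longrightarrow> br a b \<in> H"
  using subalgebra_H by (auto simp: lie_subalgebra_def)

lemma br_MH: "m \<in> M \<Longrightarrow> a \<in> H \<Longrightarrow> br m a \<in> M"
  using br_HM[of a m] subspace_neg[OF subspace_M] br_antisym[of m a] by simp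

lemma proj_sum: "a \<in> H \<Longrightarrow> m \<in> M \<Longrightarrow> pH (a + m) = a" "a \<in> H \<Longrightarrow> m \<in> M \<Longrightarrow> pM (a + m) = m"
  using proj_along_eq[OF direct_sum vector_space_axioms, of a m]
    proj_along_eq[OF internal_direct_sum_swap[OF direct_sum] vector_space_axioms, of m a]
  by (simp_all add: add.commute)

lemma proj_parts: "pH x \<in> H" "pM x \<in> M" "pH x + pM x = x"
proof -
  have "{a + m | a m. a \<in> H \<and> m \<in> M} = UNIV"
    using direct_sum unfolding internal_direct_sum_def by metis
  then obtain a m where x: "x = a + m" "a \<in> H" "m \<in> M" by blast
  then show "pH x \<in> H" "pM x \<in> M" "pH x + pM x = x" by (simp_all add: proj_sum)
qed

lemma proj_eqI: "x = a + m \<Longrightarrow> a \<in> H \<Longrightarrow> m \<in> M \<Longrightarrow> pH x = a \<and> pM x = m"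
  by (simp add: proj_sum)

lemma proj_on_parts [simp]:
  "a \<in> H \<Longrightarrow> pH a = a" "a \<in> H \<Longrightarrow> pM a = 0" "m \<in> M \<Longrightarrow> pH m = 0" "m \<in> M \<Longrightarrow> pM m = m"
  using proj_sum[of a 0] proj_sum[of 0 m] subspace_0[OF subspace_H] subspace_0[OF subspace_M] by auto

lemma proj_add: "pH (x + y) = pH x + pH y" "pM (x + y) = pM x + pM y"
proof -
  have "x + y = (pH x + pH y) + (pM x + pM y)"
    using proj_parts(3)[of x] proj_parts(3)[of y] by (metis add.assoc add.left_commute)
  then have "pH (x + y) = pH x + pH y \<and> pM (x + y) = pM x + pM y"
    using proj_parts by (intro proj_eqI subspace_add[OF subspace_H] subspace_add[OF subspace_M]) auto
  then show "pH (x + y) = pH x + pH y" "pM (x + y) = pM x + pM y" by blast+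
qed

lemma proj_scale: "pH (c *s x) = c *s pH x" "pM (c *s x) = c *s pM x"
proof -
  have "c *s x = c *s pH x + c *s pM x"
    using proj_parts(3)[of x] by (metis scale_right_distrib)
  then have "pH (c *s x) = c *s pH x \<and> pM (c *s x) = c *s pM x"
    using proj_parts by (intro proj_eqI subspace_scale[OF subspace_H] subspace_scale[OF subspace_M]) auto
  then show "pH (c *s x) = c *s pH x" "pM (c *s x) = c *s pM x" by blast+
qed

text \<open>
  Both summands are invariant under \<open>H\<close>; this is where the decomposition has to be reductive.
\<close>

lemma proj_equivariant:
  assumes "a \<in> H" shows "pH (br a x) = br a (pH x)" "pM (br a x) = br a (pM x)"
proof -
  have "br a x = br a (pH x) + br a (pM x)"
    using proj_parts(3)[of x] by (metis br_add_right)
  then have "pH (br a x) = br a (pH x) \<and> pM (br a x) = br a (pM x)"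
    using proj_parts assms by (intro proj_eqI br_HH br_HM) auto
  then show "pH (br a x) = br a (pH x)" "pM (br a x) = br a (pM x)" by blast+
qed

lemma proj_zero [simp]: "pH 0 = 0" "pM 0 = 0"
  using subspace_0[OF subspace_H] by simp_all

lemma cyclic_br: "br (br x y) z + br (br y z) x + br (br z x) y = 0"
  by (rule jacobi) simp_all

text \<open>
  LY3 and LY4 are the \<open>M\<close>-part and the \<open>H\<close>-part of the Jacobi identity for three elements of \<open>M\<close>. LY5
  and LY6 hold because the triple product acts by elements of \<open>H\<close>, which act as derivations
  commuting with the projections.
\<close>

lemma lie_yamaguti:
  "lie_yamaguti_algebra scale M (reductive_product br H M) (reductive_triple br H M)"
proof
  show "subspace M" by (rule subspace_M)
  show "bilinear_on scale M scale M (reductive_product br H M)"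
    unfolding bilinear_on_def linear_on_def reductive_product_def
    by (simp add: proj_parts br_add_left br_add_right br_scale_left br_scale_right proj_add proj_scale)
  show "trilinear_on scale M (reductive_triple br H M)"
    unfolding trilinear_on_def linear_on_def reductive_triple_def
    by (simp add: br_HM proj_parts br_add_left br_add_right br_scale_left br_scale_right proj_add proj_scale)
  show "reductive_product br H M x x = 0" for x
    by (simp add: reductive_product_def)
  show "reductive_triple br H M x x y = 0" for x y
    by (simp add: reductive_triple_def)
  have triple: "reductive_triple br H M x y z = pM (br (pH (br x y)) z)" if "z \<in> M" for x y z
    using that by (simp add: reductive_triple_def br_HM proj_parts)
  show "(reductive_triple br H M x y z + reductive_product br H M (reductive_product br H M x y) z)
      + (reductive_triple br H M y z x + reductive_product br H M (reductive_product br H M y z) x)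
      + (reductive_triple br H M z x y + reductive_product br H M (reductive_product br H M z x) y) = 0"
    if "x \<in> M" "y \<in> M" "z \<in> M" for x y z
  proof -
    have part: "reductive_triple br H M u v w + reductive_product br H M (reductive_product br H M u v) w
        = pM (br (br u v) w)" if "w \<in> M" for u v w
      unfolding triple[OF that] reductive_product_def
      by (simp only: proj_add[symmetric] br_add_left[symmetric] proj_parts)
    show ?thesis using that by (simp add: part proj_add[symmetric] cyclic_br)
  qed
  show "reductive_triple br H M (reductive_product br H M x y) z t
      + reductive_triple br H M (reductive_product br H M y z) x t
      + reductive_triple br H M (reductive_product br H M z x) y t = 0"
    if "x \<in> M" "y \<in> M" "z \<in> M" for x y z t
  proof -
    have part: "pH (br (pM (br u v)) w) = pH (br (br u v) w)" if "w \<in> M" for u v w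
    proof -
      have "br (br u v) w = br (pH (br u v)) w + br (pM (br u v)) w"
        by (simp only: br_add_left[symmetric] proj_parts)
      then show ?thesis using that by (simp add: proj_add br_HM proj_parts)
    qed
    show ?thesis
      using that unfolding reductive_triple_def reductive_product_def
      by (simp add: part br_add_left[symmetric] proj_add[symmetric] cyclic_br)
  qed
  show "reductive_triple br H M x y (reductive_product br H M u v)
      = reductive_product br H M (reductive_triple br H M x y u) v
        + reductive_product br H M u (reductive_triple br H M x y v)" for x y u v
    unfolding reductive_triple_def reductive_product_def
    by (simp add: proj_equivariant[symmetric] proj_parts br_derivation[of "pH (br x y)" u v]
        proj_add[symmetric])
  show "reductive_triple br H M x y (reductive_triple br H M u v w)
      = reductive_triple br H M (reductive_triple br H M x y u) v w
        + reductive_triple br H M u (reductive_triple br H M x y v) w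
        + reductive_triple br H M u v (reductive_triple br H M x y w)" for x y u v w
    unfolding reductive_triple_def
    by (simp add: br_derivation[of "pH (br x y)" "pH (br u v)" w]
        proj_equivariant[OF proj_parts(1), symmetric] br_derivation[of "pH (br x y)" u v]
        proj_add br_add_left)
qed

text \<open>
  The action of \<open>a\<close> on \<open>M\<close>, extended by \<open>0\<close> in the same way as the inner derivations.
\<close>

definition ad_M :: "'g \<Rightarrow> 'g \<Rightarrow> 'g" where
  "ad_M a = (\<lambda>z. if z \<in> M then br a z else 0)"

lemma ad_M_add: "ad_M (a + b) = ad_M a + ad_M b"
  and ad_M_scale: "ad_M (c *s a) = fun_scale scale c (ad_M a)"
  by (auto simp: ad_M_def fun_eq_iff fun_scale_def br_add_left br_scale_left)

lemma ad_M_commutator: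
  assumes "a \<in> H" "b \<in> H" shows "ad_M (br a b) = fun_commutator (ad_M a) (ad_M b)"
  using assms br_derivation[of a b]
  by (auto simp: ad_M_def fun_commutator_def fun_eq_iff br_HM)

lemma inner_derivation_eq_ad_M: "inner_derivation M (reductive_triple br H M) x y = ad_M (pH (br x y))"
  by (simp add: inner_derivation_def ad_M_def reductive_triple_def fun_eq_iff)

end

section \<open>Reductive decompositions of simple Lie algebras\<close>

locale simple_reductive_lie_algebra = reductive_lie_algebra +
  assumes simple: "simple_lie_algebra scale UNIV br"
    and M_nonzero: "M \<noteq> {0}"
begin

lemma ideal_trivial:
  assumes "subspace I" "\<And>x y. y \<in> I \<Longrightarrow> br x y \<in> I"
  shows "I = {0} \<or> I = UNIV"
  using simple assms by (auto simp: simple_lie_algebra_def lie_ideal_def)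

text \<open>
  The left-hand side \<open>I\<close> is invariant under \<open>H\<close>, and brackets of elements of \<open>M\<close> lie in \<open>I + M\<close>, so
  \<open>I + M\<close> is an ideal. It contains \<open>M\<close>, hence it is everything, and comparing \<open>H\<close>-parts gives \<open>I = H\<close>.
\<close>

lemma span_pH_brackets: "span {pH (br x y) | x y. x \<in> M \<and> y \<in> M} = H"
proof -
  let ?I = "span {pH (br x y) | x y. x \<in> M \<and> y \<in> M}"
  let ?J = "{i + m | i m. i \<in> ?I \<and> m \<in> M}"
  have IH: "?I \<subseteq> H" using proj_parts subspace_H by (intro span_minimal) auto
  have inv: "br a i \<in> ?I" if a: "a \<in> H" and "i \<in> ?I" for a i
    using that(2)
  proof (induction rule: span_induct)
    case base
    show ?case
      by (intro subspaceI) (auto simp: br_add_right br_scale_right span_zero intro: span_add span_scale)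
  next
    case (step i)
    then obtain x y where i: "i = pH (br x y)" "x \<in> M" "y \<in> M" by blast
    have "br a i = pH (br (br a x) y) + pH (br x (br a y))"
      unfolding i proj_equivariant(1)[OF a, symmetric] br_derivation[of a x y] proj_add ..
    moreover have "pH (br (br a x) y) \<in> ?I" "pH (br x (br a y)) \<in> ?I"
      using i br_HM[OF a] by (auto intro!: span_base)
    ultimately show ?case by (simp add: span_add)
  qed
  have "?J = {0} \<or> ?J = UNIV"
  proof (rule ideal_trivial)
    show "subspace ?J" using subspace_sums[OF subspace_span subspace_M] by simp
    fix x y assume "y \<in> ?J"
    then obtain i m where y: "y = i + m" "i \<in> ?I" "m \<in> M" by blast
    have "br x y = (br (pH x) i + pH (br (pM x) m))
        + (br (pH x) m + br (pM x) i + pM (br (pM x) m))"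
    proof -
      have "br x y = br (pH x) y + br (pM x) y"
        by (simp only: br_add_left[symmetric] proj_parts)
      moreover have "br (pM x) m = pH (br (pM x) m) + pM (br (pM x) m)"
        by (simp only: proj_parts)
      ultimately show ?thesis
        unfolding y(1) br_add_right by (metis (no_types, lifting) add.assoc add.left_commute)
    qed
    moreover have "pH (br (pM x) m) \<in> ?I"
      using y(3) proj_parts(2)[of x] by (intro span_base) blast
    then have "br (pH x) i + pH (br (pM x) m) \<in> ?I"
      by (intro span_add inv proj_parts(1) y(2))
    moreover have "br (pH x) m + br (pM x) i + pM (br (pM x) m) \<in> M"
      using y IH proj_parts by (intro subspace_add[OF subspace_M] br_HM br_MH) auto
    ultimately show "br x y \<in> ?J" by blast
  qed
  moreover have "M \<subseteq> ?J" using span_zero by force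
  ultimately have J: "?J = UNIV" using M_nonzero subspace_0[OF subspace_M] by blast
  have "a \<in> ?I" if a: "a \<in> H" for a
  proof -
    obtain i m where im: "a = i + m" "i \<in> ?I" "m \<in> M" using J by blast
    then have "a = i" using proj_sum(1)[of i m] IH a by (simp add: subset_iff)
    with im show ?thesis by simp
  qed
  with IH show ?thesis by blast
qed

text \<open>
  The annihilator of \<open>M\<close> in \<open>H\<close> is an ideal of the whole algebra. It is proper, because a nonzero
  element of \<open>M\<close> does not lie in \<open>H\<close>.
\<close>

lemma faithful:
  assumes "a \<in> H" "\<And>m. m \<in> M \<Longrightarrow> br a m = 0"
  shows "a = 0"
proof -
  let ?K = "{a \<in> H. \<forall>m\<in>M. br a m = 0}"
  have "?K = {0} \<or> ?K = UNIV"
  proof (rule ideal_trivial)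
    show "subspace ?K"
      using subspace_H
      by (intro subspaceI) (auto simp: br_add_left br_scale_left subspace_0 subspace_add subspace_scale)
    fix x a assume a: "a \<in> ?K"
    have "br (pM x) a = 0" using a proj_parts(2)[of x] br_antisym[of "pM x" a] by simp
    then have "br x a = br (pH x) a"
      using proj_parts(3)[of x] br_add_left[of "pH x" "pM x" a] by simp
    moreover have "br (br (pH x) a) m = 0" if "m \<in> M" for m
      using br_derivation[of "pH x" a m] a that br_HM[OF proj_parts(1)] by simp
    ultimately show "br x a \<in> ?K" using a br_HH proj_parts(1) by simp
  qed
  moreover have "?K \<noteq> UNIV"
    using M_nonzero disjoint subspace_0[OF subspace_M] by blast
  ultimately show ?thesis using assms by blast
qed

lemma ad_M_image: "ad_M ` H = inner_derivations scale M (reductive_triple br H M)"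
proof -
  interpret F: vector_space "fun_scale scale"
    using vector_space_axioms by (rule vector_space_fun_scale)
  have "Vector_Spaces.linear scale (fun_scale scale) ad_M"
    unfolding Vector_Spaces.linear_iff
    using vector_space_axioms F.vector_space_axioms ad_M_add ad_M_scale by blast
  then interpret ad_M: module_hom scale "fun_scale scale" ad_M by (rule module_hom_linearI)
  have "ad_M ` {pH (br x y) | x y. x \<in> M \<and> y \<in> M}
      = {inner_derivation M (reductive_triple br H M) x y | x y. x \<in> M \<and> y \<in> M}"
    unfolding inner_derivation_eq_ad_M by blast
  then show ?thesis
    unfolding inner_derivations_def using ad_M.span_image span_pH_brackets by metis
qed

lemma bij_ad_M: "bij_betw ad_M H (inner_derivations scale M (reductive_triple br H M))"
proof -
  have "inj_on ad_M H"
  proof (rule inj_onI)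
    fix a b assume ab: "a \<in> H" "b \<in> H" "ad_M a = ad_M b"
    have "a - b = 0"
    proof (rule faithful)
      show "a - b \<in> H" using subspace_H ab(1,2) by (rule subspace_diff)
      show "br (a - b) m = 0" if "m \<in> M" for m
        using fun_cong[OF ab(3), of m] that by (simp add: ad_M_def br_diff_left)
    qed
    then show "a = b" by simp
  qed
  then show ?thesis using ad_M_image by (simp add: bij_betw_def)
qed

lemma subspace_inner_derivations:
  "module.subspace (fun_scale scale) (inner_derivations scale M (reductive_triple br H M))"
proof -
  interpret F: vector_space "fun_scale scale"
    using vector_space_axioms by (rule vector_space_fun_scale)
  show ?thesis unfolding inner_derivations_def by (rule F.subspace_span)
qed

lemma isotropy_isomorphic:
  "lie_isomorphic scale H br
     (fun_scale scale) (inner_derivations scale M (reductive_triple br H M)) fun_commutator"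
proof (rule lie_isomorphicI)
  show "linear_on scale H (fun_scale scale) (inner_derivations scale M (reductive_triple br H M)) ad_M"
    using ad_M_image by (auto simp: linear_on_def ad_M_add ad_M_scale)
qed (use lie_algebra_subalgebra[OF subalgebra_H] vector_space_fun_scale[OF vector_space_axioms]
    subspace_inner_derivations bij_ad_M ad_M_commutator in auto)

lemma enveloping_isomorphic:
  "lie_isomorphic scale UNIV br
     (enveloping_scale scale) (enveloping_carrier scale M (reductive_triple br H M))
     (enveloping_bracket M (reductive_product br H M) (reductive_triple br H M))"
proof (rule lie_isomorphicI)
  let ?D = "inner_derivations scale M (reductive_triple br H M)"
  let ?f = "\<lambda>x. (ad_M (pH x), pM x)"
  interpret F: vector_space "fun_scale scale"
    using vector_space_axioms by (rule vector_space_fun_scale)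
  interpret E: vector_space "enveloping_scale scale"
    using vector_space_axioms by (rule vector_space_enveloping_scale)
  show "lie_algebra scale UNIV br" by (rule lie_algebra_axioms)
  show "vector_space (enveloping_scale scale)" by (rule E.vector_space_axioms)
  show "E.subspace (enveloping_carrier scale M (reductive_triple br H M))"
    using subspace_inner_derivations subspace_M unfolding enveloping_carrier_def
    by (intro E.subspaceI)
      (auto simp: enveloping_scale_def zero_prod_def F.subspace_0 F.subspace_add F.subspace_scale
        subspace_0 subspace_add subspace_scale)
  show "linear_on scale UNIV (enveloping_scale scale) (enveloping_carrier scale M (reductive_triple br H M)) ?f"
    unfolding linear_on_def enveloping_carrier_def
    using ad_M_image proj_parts
    by (auto simp: proj_add proj_scale ad_M_add ad_M_scale enveloping_scale_def)
  show "bij_betw ?f UNIV (enveloping_carrier scale M (reductive_triple br H M))"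
    unfolding bij_betw_def
  proof
    show "inj ?f"
    proof (rule injI)
      fix x y assume "?f x = ?f y"
      then have "pH x = pH y" "pM x = pM y"
        using bij_betw_imp_inj_on[OF bij_ad_M] proj_parts(1) by (auto dest: inj_onD)
      then show "x = y" using proj_parts(3) by metis
    qed
    have "(d, m) \<in> range ?f" if d: "d \<in> ?D" and m: "m \<in> M" for d m
    proof -
      obtain a where "a \<in> H" "d = ad_M a" using d ad_M_image by blast
      then have "(d, m) = ?f (a + m)" using m by (simp add: proj_sum)
      then show ?thesis by blast
    qed
    then show "range ?f = enveloping_carrier scale M (reductive_triple br H M)"
      unfolding enveloping_carrier_def using ad_M_image proj_parts by auto
  qed
  show "?f (br x y) = enveloping_bracket M (reductive_product br H M) (reductive_triple br H M) (?f x) (?f y)"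
    for x y
  proof -
    have "br x y = br (pH x + pM x) (pH y + pM y)" by (simp only: proj_parts)
    also have "\<dots> = br (pH x) (pH y) + (br (pH x) (pM y) - br (pH y) (pM x)) + br (pM x) (pM y)"
      using br_antisym[of "pM x" "pH y"] by (simp add: br_add_left br_add_right algebra_simps)
    finally have xy: "br x y = br (pH x) (pH y) + (br (pH x) (pM y) - br (pH y) (pM x)) + br (pM x) (pM y)" .
    have HH: "br (pH x) (pH y) \<in> H" using proj_parts br_HH by blast
    have MM: "br (pH x) (pM y) - br (pH y) (pM x) \<in> M"
      using proj_parts by (intro subspace_diff[OF subspace_M] br_HM) auto
    have "pH (br x y) = br (pH x) (pH y) + pH (br (pM x) (pM y))"
      using HH MM by (subst xy) (simp add: proj_add)
    moreover have "pM (br x y) = br (pH x) (pM y) - br (pH y) (pM x) + pM (br (pM x) (pM y))"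
      using HH MM by (subst xy) (simp add: proj_add)
    ultimately show ?thesis
      by (simp add: enveloping_bracket_def inner_derivation_eq_ad_M ad_M_add ad_M_commutator proj_parts
          ad_M_def[of "pH x" ] ad_M_def[of "pH y"] reductive_product_def)
  qed
qed

end

section \<open>The isotropy module and the orthogonal complement\<close>

lemma (in fd_lie_algebra) semisimple_no_abelian_ideal:
  assumes ss: "semisimple_lie_algebra scale H br" and H: "lie_subalgebra scale UNIV br H"
    and A: "subspace A" "A \<subseteq> H" "\<And>x a. x \<in> H \<Longrightarrow> a \<in> A \<Longrightarrow> br x a \<in> A"
    and abelian: "\<And>a b. a \<in> A \<Longrightarrow> b \<in> A \<Longrightarrow> br a b = 0"
  shows "A = {0}"
proof -
  have "lie_subalgebra scale UNIV br A"
    using A by (auto simp: lie_subalgebra_def)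
  then have "lie_algebra scale A br" by (rule lie_algebra_subalgebra)
  moreover have "derived_series scale A br (Suc 0) = {0}"
  proof -
    have "{br a b | a b. a \<in> A \<and> b \<in> A} \<subseteq> {0}" using abelian by blast
    then have "span {br a b | a b. a \<in> A \<and> b \<in> A} = {0}"
      using span_minimal[OF _ subspace_single_0] span_zero by blast
    then show ?thesis by simp
  qed
  ultimately have "solvable_lie_algebra scale A br"
    unfolding solvable_lie_algebra_def by blast
  moreover have "lie_ideal scale H br A" using A by (auto simp: lie_ideal_def)
  ultimately show ?thesis using ss unfolding semisimple_lie_algebra_def by blast
qed

context simple_reductive_lie_algebra
begin

text \<open>
  By invariance of the form, its radical on an ideal \<open>I\<close> of \<open>H\<close> is again an ideal of \<open>H\<close>, and the form
  vanishes on it.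
\<close>

lemma killing_nondegenerate_on_ideal:
  assumes ss: "semisimple_lie_algebra scale H br"
    and I: "subspace I" "I \<subseteq> H" "\<And>x i. x \<in> H \<Longrightarrow> i \<in> I \<Longrightarrow> br x i \<in> I"
    and s: "s \<in> I" "\<And>t. t \<in> I \<Longrightarrow> kf s t = 0"
  shows "s = 0"
proof -
  let ?R = "{s \<in> I. \<forall>t\<in>I. kf s t = 0}"
  have "?R = {0}"
  proof (rule isotropic_ideal_zero)
    show "A = {0}" if "subspace A" "A \<subseteq> H" "\<And>x a. x \<in> H \<Longrightarrow> a \<in> A \<Longrightarrow> br x a \<in> A"
      "\<And>a b. a \<in> A \<Longrightarrow> b \<in> A \<Longrightarrow> br a b = 0" for A
      using ss subalgebra_H that by (rule semisimple_no_abelian_ideal)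
    show "subspace ?R"
      using I(1)
      by (intro subspaceI) (auto simp: kf_add_left kf_scale_left subspace_0 subspace_add subspace_scale)
    show "?R \<subseteq> H" using I(2) by blast
    show "kf a b = 0" if "a \<in> ?R" "b \<in> ?R" for a b using that by blast
    fix x r assume x: "x \<in> H" and r: "r \<in> ?R"
    have "kf (br x r) t = 0" if "t \<in> I" for t
    proof -
      have "kf (br x r) t = - kf (br r x) t"
        using br_antisym[of x r] kf_scale_left[of "- 1"] by simp
      also have "\<dots> = - kf r (br x t)" by (simp only: kf_invariant)
      finally show ?thesis using r I(3)[OF x that] by simp
    qed
    then show "br x r \<in> ?R" using r I(3)[OF x] by blast
  qed
  with s show ?thesis by blast
qed

text \<open>
  The orthogonal projection \<open>p\<close> onto \<open>H\<close> is a homomorphism of \<open>H\<close>-modules. If it vanished on \<open>M\<close>, then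
  \<open>M\<close> would be the orthogonal complement of \<open>H\<close>; so it is injective on the irreducible module \<open>M\<close>.
  It is onto \<open>H\<close> because an element of \<open>H\<close> orthogonal to its image \<open>p ` M\<close> kills \<open>p ` M\<close>, hence \<open>M\<close>,
  and so vanishes. The isomorphism is the inverse of \<open>p\<close>.
\<close>

lemma isotropy_module_dichotomy:
  assumes ss: "semisimple_lie_algebra scale H br"
    and irr: "irreducible_lie_module scale H br scale M br"
    and neq: "M \<noteq> orthogonal_complement UNIV kf H"
  shows "isomorphic_lie_modules scale H br scale H br scale M br"
proof -
  have nondeg_H: "s = 0" if "s \<in> H" "\<And>t. t \<in> H \<Longrightarrow> kf s t = 0" for s
    using killing_nondegenerate_on_ideal[OF ss subspace_H subset_refl] br_HH that by blast
  have irreducible: "W = {0} \<or> W = M"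
    if "W \<subseteq> M" "subspace W" "\<And>x w. x \<in> H \<Longrightarrow> w \<in> W \<Longrightarrow> br x w \<in> W" for W
    using irr that unfolding irreducible_lie_module_def by blast
  have "\<forall>x. \<exists>s\<in>H. \<forall>t\<in>H. kf (x - s) t = 0"
    using orthogonal_projection_exists[OF subspace_H nondeg_H] by blast
  then obtain p where p: "\<And>x. p x \<in> H" "\<And>x t. t \<in> H \<Longrightarrow> kf (x - p x) t = 0"
    by metis
  have p_eqI: "p x = s" if "s \<in> H" "\<And>t. t \<in> H \<Longrightarrow> kf (x - s) t = 0" for x s
  proof -
    have "kf (p x - s) t = 0" if t: "t \<in> H" for t
      using p(2)[OF t, of x] \<open>\<And>t. t \<in> H \<Longrightarrow> kf (x - s) t = 0\<close>[OF t] by (simp add: kf_diff_left)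
    then have "p x - s = 0"
      using nondeg_H subspace_diff[OF subspace_H p(1) that(1)] by blast
    then show ?thesis by simp
  qed
  have p_add: "p (x + y) = p x + p y" for x y
  proof (rule p_eqI)
    show "p x + p y \<in> H" using subspace_H p(1) p(1) by (rule subspace_add)
    show "kf (x + y - (p x + p y)) t = 0" if "t \<in> H" for t
      using p(2)[OF that, of x] p(2)[OF that, of y] by (simp add: kf_diff_left kf_add_left)
  qed
  have p_scale: "p (c *s x) = c *s p x" for c x
  proof (rule p_eqI)
    show "c *s p x \<in> H" using subspace_H p(1) by (rule subspace_scale)
    show "kf (c *s x - c *s p x) t = 0" if "t \<in> H" for t
      using p(2)[OF that, of x] by (simp add: kf_diff_left kf_scale_left)
  qed
  have p_br: "p (br a x) = br a (p x)" if a: "a \<in> H" for a x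
  proof (rule p_eqI)
    show "br a (p x) \<in> H" using a p(1) by (rule br_HH)
    show "kf (br a x - br a (p x)) t = 0" if t: "t \<in> H" for t
    proof -
      have "br a x - br a (p x) = - br (x - p x) a"
        using br_antisym[of "x - p x" a] by (simp add: br_diff_right)
      then have "kf (br a x - br a (p x)) t = - kf (x - p x) (br a t)"
        using kf_scale_left[of "- 1" "br (x - p x) a" t] by (simp add: kf_invariant)
      then show ?thesis using p(2)[OF br_HH[OF a t]] by simp
    qed
  qed
  have p_0: "p 0 = 0" using p_scale[of 0 0] by simp
  let ?ker = "{m \<in> M. p m = 0}"
  have "?ker \<noteq> M"
  proof
    assume ker: "?ker = M"
    have orth: "kf m t = 0" if "m \<in> M" "t \<in> H" for m t
      using p(2)[OF that(2), of m] ker that(1) by force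
    have "x \<in> M" if x: "\<And>t. t \<in> H \<Longrightarrow> kf x t = 0" for x
    proof -
      have "kf (pH x) t = 0" if "t \<in> H" for t
      proof -
        have "kf x t = kf (pH x) t + kf (pM x) t"
          by (simp only: kf_add_left[symmetric] proj_parts)
        then show ?thesis using x[OF that] orth[OF proj_parts(2) that] by simp
      qed
      then have "pH x = 0" using nondeg_H proj_parts(1) by blast
      then show ?thesis using proj_parts(2,3)[of x] by simp
    qed
    then have "M = orthogonal_complement UNIV kf H"
      using orth unfolding orthogonal_complement_def by blast
    with neq show False by blast
  qed
  moreover have "?ker = {0} \<or> ?ker = M"
  proof (rule irreducible)
    show "subspace ?ker"
      using subspace_M
      by (intro subspaceI) (auto simp: p_0 p_add p_scale subspace_0 subspace_add subspace_scale)
  qed (auto simp: p_br br_HM)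
  ultimately have ker: "?ker = {0}" by blast
  have inj: "inj_on p M"
  proof (rule inj_onI)
    fix x y assume xy: "x \<in> M" "y \<in> M" "p x = p y"
    have "p (x - y) = 0" using p_add[of "x - y" y] xy(3) by simp
    then have "x - y \<in> ?ker" using subspace_diff[OF subspace_M xy(1,2)] by blast
    with ker show "x = y" by simp
  qed
  let ?I = "p ` M"
  have I: "subspace ?I" "?I \<subseteq> H" "\<And>x i. x \<in> H \<Longrightarrow> i \<in> ?I \<Longrightarrow> br x i \<in> ?I"
  proof -
    have "linear_endo p" by (rule linear_endoI) (simp_all add: p_add p_scale)
    then show "subspace ?I"
      using module_hom.subspace_image[OF module_hom_linearI] subspace_M by blast
    show "?I \<subseteq> H" using p(1) by blast
    show "br x i \<in> ?I" if "x \<in> H" "i \<in> ?I" for x i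
      using that p_br br_HM by (metis (no_types, lifting) imageE imageI)
  qed
  have nondeg_I: "s = 0" if "s \<in> ?I" "\<And>t. t \<in> ?I \<Longrightarrow> kf s t = 0" for s
    using ss I that by (rule killing_nondegenerate_on_ideal)
  have orth_I: "a = 0" if a: "a \<in> H" and orth: "\<And>t. t \<in> ?I \<Longrightarrow> kf a t = 0" for a
    using a
  proof (rule faithful)
    fix m assume m: "m \<in> M"
    \<comment> \<open>this bracket lies in the ideal \<open>?I\<close> and is orthogonal to it\<close>
    have "br a (p m) \<in> ?I" using I(3)[OF a] m by blast
    moreover have "kf (br a (p m)) t = 0" if t: "t \<in> ?I" for t
    proof -
      have "br (p m) t \<in> ?I" using I(3) t p(1) by blast
      then show ?thesis unfolding kf_invariant by (rule orth)
    qed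
    ultimately have "br a (p m) = 0" by (rule nondeg_I)
    then have "br a m \<in> ?ker" using p_br[OF a] br_HM[OF a m] by simp
    with ker show "br a m = 0" by blast
  qed
  have "H \<subseteq> ?I"
  proof
    fix a assume a: "a \<in> H"
    have "\<exists>s\<in>?I. \<forall>t\<in>?I. kf (a - s) t = 0"
      using I(1) nondeg_I by (rule orthogonal_projection_exists)
    then obtain s where s: "s \<in> ?I" "\<And>t. t \<in> ?I \<Longrightarrow> kf (a - s) t = 0" by blast
    have "s \<in> H" using s(1) I(2) by blast
    with subspace_H a have "a - s \<in> H" by (rule subspace_diff)
    then have "a - s = 0" using s(2) by (rule orth_I)
    with s(1) show "a \<in> ?I" by simp
  qed
  with I(2) have bij: "bij_betw p M H" using inj by (auto simp: bij_betw_def)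
  let ?f = "inv_into M p"
  have f: "?f a \<in> M" "p (?f a) = a" if "a \<in> H" for a
    using bij that by (auto simp: bij_betw_def inv_into_into f_inv_into_f)
  have f_eqI: "?f a = m" if "m \<in> M" "p m = a" for a m
    using inj that by auto
  have "linear_on scale H scale M ?f"
    unfolding linear_on_def
  proof (intro conjI ballI allI)
    show "?f a \<in> M" if "a \<in> H" for a using f that by blast
    show "?f (a + b) = ?f a + ?f b" if "a \<in> H" "b \<in> H" for a b
      using f that by (intro f_eqI subspace_add[OF subspace_M]) (auto simp: p_add)
    show "?f (c *s a) = c *s ?f a" if "a \<in> H" for c a
      using f that by (intro f_eqI subspace_scale[OF subspace_M]) (auto simp: p_scale)
  qed
  moreover have "bij_betw ?f H M" using bij by (rule bij_betw_inv_into)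
  moreover have "\<forall>a\<in>H. \<forall>b\<in>H. ?f (br a b) = br a (?f b)"
    using f by (intro ballI f_eqI br_HM) (auto simp: p_br)
  moreover have "lie_module scale H br scale H br"
  proof -
    have alg: "lie_algebra scale H br" using subalgebra_H by (rule lie_algebra_subalgebra)
    moreover have "bilinear_on scale H scale H br" using alg by (rule lie_algebra.bilinear)
    moreover have "br (br x y) z = br x (br y z) - br y (br x z)" for x y z
      using br_derivation[of x y z] by simp
    ultimately show ?thesis
      unfolding lie_module_def using vector_space_axioms subspace_H by blast
  qed
  moreover have "lie_module scale H br scale M br"
    using irr by (simp add: irreducible_lie_module_def)
  ultimately show ?thesis unfolding isomorphic_lie_modules_def by blast
qed

end

theorem proposition1p3:
  fixes scale :: "'k::{alg_closed_field, field_char_0} \<Rightarrow> 'g::ab_group_add \<Rightarrow> 'g"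
    and Basis :: "'g set"
    and br :: "'g \<Rightarrow> 'g \<Rightarrow> 'g"
    and H M :: "'g set"
  assumes "finite_dimensional_vector_space scale Basis"
    and "simple_lie_algebra scale UNIV br"
    and "reductive_decomposition scale UNIV br H M"
    and "M \<noteq> {0}"
  shows "lie_yamaguti_algebra scale M (reductive_product br H M) (reductive_triple br H M) \<and>
    lie_isomorphic scale UNIV br
      (enveloping_scale scale) (enveloping_carrier scale M (reductive_triple br H M))
      (enveloping_bracket M (reductive_product br H M) (reductive_triple br H M)) \<and>
    lie_isomorphic scale H br
      (fun_scale scale) (inner_derivations scale M (reductive_triple br H M)) fun_commutator \<and>
    (semisimple_lie_algebra scale H br \<and> irreducible_lie_module scale H br scale M br \<longrightarrow>
      isomorphic_lie_modules scale H br scale H br scale M br \<or>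
      M = orthogonal_complement UNIV (killing_form scale Basis br) H)"
proof -
  interpret finite_dimensional_vector_space scale Basis by fact
  interpret lie_algebra scale UNIV br using assms(2) by (simp add: simple_lie_algebra_def)
  interpret simple_reductive_lie_algebra scale Basis br H M
    using assms(2-4) by unfold_locales
  show ?thesis
    using lie_yamaguti enveloping_isomorphic isotropy_isomorphic isotropy_module_dichotomy by blast
qed

end
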